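(* Let $p$ be a prime, let $\mathcal{F}$ be a saturated fusion system over a finite $p$-group $S$, and let $\mathcal{G}=N_{\mathcal{F}}(S)$ or $\mathcal{G}=\mathcal{F}_S(S)$. Suppose that $\mathrm{Hom}_{\mathcal{G}}(A,B)=\mathrm{Hom}_{\mathcal{F}}(A,B)$ for all $A,B \leq \mathfrak{hyp}(\mathcal{F})$ which are cyclic subgroups of order $p$ or $4$. Then $\mathcal{G}=\mathcal{F}$.
   Context: For subgroups $P,Q$ of a finite $p$-group $S$, $\mathrm{Hom}_S(P,Q)$ is the set of homomorphisms $P\to Q$ induced by conjugation by elements of $S$, and $\mathrm{Aut}_S(P)=\mathrm{Hom}_S(P,P)$. A fusion system $\mathcal{F}$ over $S$ is a category whose objects are the subgroups of $S$ and whose morphism sets $\mathrm{Hom}_{\mathcal{F}}(P,Q)$ consist of injective group homomorphisms, contain $\mathrm{Hom}_S(P,Q)$, and are such that every morphism is the composite of an isomorphism in $\mathcal{F}$ followed by an inclusion. Write $\mathrm{Aut}_{\mathcal{F}}(P)=\mathrm{Hom}_{\mathcal{F}}(P,P)$. The fusion system $\mathcal{F}$ is saturated if every subgroup of $S$ is isomorphic in $\mathcal{F}$ to a subgroup $P\le S$ such that (i) $\mathrm{Aut}_S(P)$ is a Sylow $p$-subgroup of $\mathrm{Aut}_{\mathcal{F}}(P)$, and (ii) every isomorphism $\varphi\colon Q\to P$ in $\mathcal{F}$ extends to a morphism in $\mathrm{Hom}_{\mathcal{F}}(N_\varphi,S)$, where $N_\varphi=\{g\in N_S(Q): \varphi\circ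 c_g\circ\varphi^{-1}\in \mathrm{Aut}_S(P)\}$ and $c_g$ denotes conjugation by $g$. $\mathcal{F}_S(S)$ is the fusion system over $S$ with morphism sets $\mathrm{Hom}_S(P,Q)$. $N_{\mathcal{F}}(S)$ is the fusion system over $S$ in which $\mathrm{Hom}_{N_{\mathcal{F}}(S)}(P,Q)$ consists of those $\varphi\in\mathrm{Hom}_{\mathcal{F}}(P,Q)$ which extend to an element of $\mathrm{Aut}_{\mathcal{F}}(S)$. For a finite group $X$, $O^p(X)$ denotes the smallest normal subgroup of $X$ of $p$-power index. The hyperfocal subgroup $\mathfrak{hyp}(\mathcal{F})$ is the subgroup of $S$ generated by all elements of the form $x^{-1}\varphi(x)$ where $x\in Q$ and $\varphi\in O^p(\mathrm{Aut}_{\mathcal{F}}(Q))$ for some subgroup $Q$ of $S$. *)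

theory Defs
  imports "HOL-Algebra.Group_Action" "HOL-Algebra.Elementary_Groups"
    "HOL-Computational_Algebra.Primes"
begin

section \<open>Finite p-groups and fusion systems\<close>

locale finite_p_group = group S for S (structure) +
  fixes p :: nat
  assumes prime: "prime p"
    and finite_carrier: "finite (carrier S)"
    and p_power_order: "\<exists>n. order S = p ^ n"

text \<open>
  A homomorphism with domain \<open>P\<close> is represented by a function that is \<^const>\<open>extensional\<close>
  on \<open>P\<close>, as in \<^const>\<open>BijGroup\<close>, so equal morphisms are equal functions. The category
  composition of \<open>\<phi>\<close> from \<open>P\<close> and \<open>\<psi>\<close> is \<open>compose P \<psi> \<phi>\<close>, and the inclusion of \<open>R\<close> is
  \<open>\<lambda>x\<in>R. x\<close>.
\<close>

definition conj_map :: "('a, 'b) monoid_scheme \<Rightarrow> 'a set \<Rightarrow> 'a \<Rightarrow> 'a \<Rightarrow> 'a" where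
  "conj_map S P g = (\<lambda>x\<in>P. g \<otimes>\<^bsub>S\<^esub> x \<otimes>\<^bsub>S\<^esub> inv\<^bsub>S\<^esub> g)"

text \<open>
  A family of morphism sets is a function of the two objects. All families considered here
  are empty at pairs that are not pairs of subgroups of \<open>S\<close>, so that equality of
  categories is equality of functions. In particular \<open>inner_fusion S\<close> is both the family
  of sets of homomorphisms induced by conjugation in \<open>S\<close> and the fusion system of \<open>S\<close>
  over itself.
\<close>

definition inner_fusion :: "('a, 'b) monoid_scheme \<Rightarrow> 'a set \<Rightarrow> 'a set \<Rightarrow> ('a \<Rightarrow> 'a) set" where
  "inner_fusion S P Q =
     {conj_map S P g | g. subgroup P S \<and> subgroup Q S \<and> g \<in> carrier S \<and> conj_map S P g ` P \<subseteq> Q}"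

definition isos :: "('a set \<Rightarrow> 'a set \<Rightarrow> ('a \<Rightarrow> 'a) set) \<Rightarrow> 'a set \<Rightarrow> 'a set \<Rightarrow> ('a \<Rightarrow> 'a) set" where
  "isos F P Q =
     {\<phi> \<in> F P Q. \<exists>\<psi> \<in> F Q P. compose P \<psi> \<phi> = (\<lambda>x\<in>P. x) \<and> compose Q \<phi> \<psi> = (\<lambda>x\<in>Q. x)}"

text \<open>Identities are morphisms by \<open>inner_le\<close>, as conjugations by the neutral element.\<close>

locale fusion_system = finite_p_group S p for S (structure) and p +
  fixes F :: "'a set \<Rightarrow> 'a set \<Rightarrow> ('a \<Rightarrow> 'a) set"
  assumes objects: "\<phi> \<in> F P Q \<Longrightarrow> subgroup P S \<and> subgroup Q S"
    and injective_hom: "\<phi> \<in> F P Q \<Longrightarrow> \<phi> \<in> mon (S\<lparr>carrier := P\<rparr>) (S\<lparr>carrier := Q\<rparr>) \<inter> extensional P"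
    and composition: "\<phi> \<in> F P Q \<Longrightarrow> \<psi> \<in> F Q R \<Longrightarrow> compose P \<psi> \<phi> \<in> F P R"
    and inner_le: "inner_fusion S P Q \<subseteq> F P Q"
    and factorization: "\<phi> \<in> F P Q \<Longrightarrow>
      \<exists>R \<chi>. subgroup R S \<and> R \<subseteq> Q \<and> \<chi> \<in> isos F P R \<and> \<phi> = compose P (\<lambda>x\<in>R. x) \<chi>"

definition Aut_group :: "('a set \<Rightarrow> 'a set \<Rightarrow> ('a \<Rightarrow> 'a) set) \<Rightarrow> 'a set \<Rightarrow> ('a \<Rightarrow> 'a) monoid" where
  "Aut_group F P = BijGroup P \<lparr>carrier := F P P\<rparr>"


section \<open>Saturation\<close>

definition sylow_subgroup :: "nat \<Rightarrow> ('a, 'b) monoid_scheme \<Rightarrow> 'a set \<Rightarrow> bool" where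
  "sylow_subgroup p G H \<longleftrightarrow> subgroup H G \<and> card H = p ^ multiplicity p (order G)"

definition N_map :: "('a, 'b) monoid_scheme \<Rightarrow> 'a set \<Rightarrow> 'a set \<Rightarrow> ('a \<Rightarrow> 'a) \<Rightarrow> 'a set" where
  "N_map S Q P \<phi> = {g \<in> normalizer S Q.
     compose P (compose Q \<phi> (conj_map S Q g)) (inv_into Q \<phi>) \<in> inner_fusion S P P}"

locale saturated_fusion_system = fusion_system +
  assumes saturated: "subgroup R S \<Longrightarrow>
    \<exists>P. subgroup P S \<and> isos F R P \<noteq> {} \<and>
      sylow_subgroup p (Aut_group F P) (inner_fusion S P P) \<and>
      (\<forall>Q \<phi>. \<phi> \<in> isos F Q P \<longrightarrow>
        (\<exists>\<psi> \<in> F (N_map S Q P \<phi>) (carrier S). restrict \<psi> Q = \<phi>))"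


section \<open>The normalizer of S and the hyperfocal subgroup\<close>

definition normalizer_fusion ::
  "('a, 'b) monoid_scheme \<Rightarrow> ('a set \<Rightarrow> 'a set \<Rightarrow> ('a \<Rightarrow> 'a) set) \<Rightarrow> 'a set \<Rightarrow> 'a set \<Rightarrow> ('a \<Rightarrow> 'a) set" where
  "normalizer_fusion S F P Q =
     {\<phi> \<in> F P Q. \<exists>\<alpha> \<in> F (carrier S) (carrier S). restrict \<alpha> P = \<phi>}"

text \<open>The order on sets is inclusion; \<open>LEAST\<close> is well defined for finite groups, see below.\<close>

definition O_upper :: "nat \<Rightarrow> ('a, 'b) monoid_scheme \<Rightarrow> 'a set" where
  "O_upper p X = (LEAST N. N \<lhd> X \<and> (\<exists>k. card (rcosets\<^bsub>X\<^esub> N) = p ^ k))"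

definition hyperfocal ::
  "nat \<Rightarrow> ('a, 'b) monoid_scheme \<Rightarrow> ('a set \<Rightarrow> 'a set \<Rightarrow> ('a \<Rightarrow> 'a) set) \<Rightarrow> 'a set" where
  "hyperfocal p S F = generate S
     {inv\<^bsub>S\<^esub> x \<otimes>\<^bsub>S\<^esub> \<phi> x | x \<phi> Q. subgroup Q S \<and> x \<in> Q \<and> \<phi> \<in> O_upper p (Aut_group F Q)}"


section \<open>The notions above are well defined\<close>

lemma (in group) p_power_index_Int:
  assumes p: "prime (p::nat)" and fin: "finite (carrier G)"
    and M: "M \<lhd> G" "card (rcosets M) = p ^ a" and N: "N \<lhd> G" "card (rcosets N) = p ^ b"
  shows "M \<inter> N \<lhd> G \<and> (\<exists>k. card (rcosets (M \<inter> N)) = p ^ k)"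
proof -
  let ?H = "(G Mod M) \<times>\<times> (G Mod N)"
  let ?h = "\<lambda>x. (M #> x, N #> x)"
  interpret gM: group "G Mod M" using M(1) by (rule normal.factorgroup_is_group)
  interpret gN: group "G Mod N" using N(1) by (rule normal.factorgroup_is_group)
  interpret H: group ?H by (rule DirProd_group) (unfold_locales)
  have hom: "?h \<in> hom G ?H"
    using normal.r_coset_hom_Mod[OF M(1)] normal.r_coset_hom_Mod[OF N(1)]
    by (auto simp: hom_def DirProd_def Pi_iff)
  interpret h: group_hom G ?H ?h by (unfold_locales) (rule hom)
  have sM: "subgroup M G" and sN: "subgroup N G" using M N by (auto simp: normal_def)
  have coset: "H #> x = H \<longleftrightarrow> x \<in> H" if "subgroup H G" "x \<in> carrier G" for H x
    using that coset_join1[OF _ that(2) that(1)] coset_join2[OF that(2) that(1)] by blast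
  have ker: "kernel G ?H ?h = M \<inter> N"
    using coset[OF sM] coset[OF sN] subgroup.mem_carrier[OF sM]
    by (auto simp: kernel_def DirProd_def FactGroup_def)
  have "card (rcosets (M \<inter> N)) = card (?h ` carrier G)"
  proof -
    let ?I = "?H\<lparr>carrier := ?h ` carrier G\<rparr>"
    have "group ?I" by (rule subgroup.subgroup_is_group[OF h.img_is_subgroup H.is_group])
    then interpret i: group_hom G ?I ?h
      using hom by (intro group_hom.intro group_hom_axioms.intro) (auto simp: hom_def is_group)
    have "kernel G ?I ?h = M \<inter> N" using ker by (simp add: kernel_def)
    then have "bij_betw (\<lambda>X. the_elem (?h ` X)) (carrier (G Mod (M \<inter> N))) (?h ` carrier G)"
      using i.FactGroup_iso_set by (simp add: iso_def)
    then show ?thesis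
      using bij_betw_same_card by (fastforce simp: FactGroup_def)
  qed
  also have "\<dots> dvd order ?H"
    by (rule dvdI[of _ _ "card (rcosets\<^bsub>?H\<^esub> (?h ` carrier G))"])
      (use H.lagrange[OF h.img_is_subgroup] in \<open>simp add: mult.commute\<close>)
  also have "order ?H = p ^ (a + b)"
    using M N by (simp add: order_def DirProd_def FactGroup_def card_cartesian_product power_add)
  finally obtain k where "card (rcosets (M \<inter> N)) = p ^ k"
    using divides_primepow_nat[OF p] by blast
  then show ?thesis using h.normal_kernel ker by auto
qed

lemma (in group) O_upper_least:
  assumes p: "prime p" and fin: "finite (carrier G)"
  shows "O_upper p G \<lhd> G" "\<exists>k. card (rcosets O_upper p G) = p ^ k"
    "\<And>M k. M \<lhd> G \<Longrightarrow> card (rcosets M) = p ^ k \<Longrightarrow> O_upper p G \<subseteq> M"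
proof -
  let ?P = "\<lambda>N. N \<lhd> G \<and> (\<exists>k. card (rcosets N) = p ^ k)"
  have sub: "N \<subseteq> carrier G" if "?P N" for N
    using that by (meson normal_imp_subgroup subgroup.subset)
  have "?P (carrier G)"
  proof -
    have "card (rcosets (carrier G)) = 1"
      using lagrange[OF subgroup_self] fin order_gt_0_iff_finite
      by (auto simp: order_def)
    then have "card (rcosets (carrier G)) = p ^ 0" by simp
    then show ?thesis using normal_self by blast
  qed
  then obtain N where N: "?P N" and min: "\<And>M. ?P M \<Longrightarrow> card N \<le> card M"
    using ex_has_least_nat[of ?P "carrier G" card] by blast
  have least: "N \<subseteq> M" if "?P M" for M
  proof -
    have "?P (N \<inter> M)" using p_power_index_Int[OF p fin] N that by blast
    then have "N \<inter> M = N"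
      using min sub[OF N] fin by (meson Int_lower1 card_seteq finite_subset)
    then show ?thesis by blast
  qed
  have eq: "O_upper p G = N"
    unfolding O_upper_def using N least by (intro Least_equality) auto
  from N least show "O_upper p G \<lhd> G" "\<exists>k. card (rcosets O_upper p G) = p ^ k"
    "\<And>M k. M \<lhd> G \<Longrightarrow> card (rcosets M) = p ^ k \<Longrightarrow> O_upper p G \<subseteq> M"
    unfolding eq by blast+
qed

context fusion_system
begin

lemma identity:
  assumes "subgroup P S" "subgroup Q S" "P \<subseteq> Q"
  shows "(\<lambda>x\<in>P. x) \<in> F P Q"
proof -
  have "conj_map S P \<one> = (\<lambda>x\<in>P. x)"
    using subgroup.mem_carrier[OF assms(1)] by (auto simp: conj_map_def)
  moreover from this have "conj_map S P \<one> ` P \<subseteq> Q" using assms(3) by auto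
  then have "conj_map S P \<one> \<in> inner_fusion S P Q"
    unfolding inner_fusion_def using assms(1,2) one_closed by blast
  ultimately show ?thesis using inner_le by auto
qed

lemma hom_into: "\<phi> \<in> F P Q \<Longrightarrow> x \<in> P \<Longrightarrow> \<phi> x \<in> Q"
  using injective_hom by (fastforce simp: mon_def hom_def)

lemma hom_ext: "\<phi> \<in> F P Q \<Longrightarrow> \<phi> \<in> extensional P"
  using injective_hom by blast

lemma hom_inj: "\<phi> \<in> F P Q \<Longrightarrow> inj_on \<phi> P"
  using injective_hom by (fastforce simp: mon_def)

lemma subgroup_finite: "subgroup P S \<Longrightarrow> finite P"
  using finite_carrier finite_subset subgroup.subset by blast

lemma endo_Bij: "F P P \<subseteq> Bij P"
proof
  fix \<phi> assume a: "\<phi> \<in> F P P"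
  have "\<phi> ` P = P"
    using a by (intro endo_inj_surj) (auto dest: objects hom_inj hom_into intro: subgroup_finite)
  then show "\<phi> \<in> Bij P" using a hom_inj hom_ext by (auto simp: Bij_def bij_betw_def)
qed

lemma iso_bij: "\<phi> \<in> isos F P Q \<Longrightarrow> bij_betw \<phi> P Q"
proof -
  assume "\<phi> \<in> isos F P Q"
  then obtain \<psi> where a: "\<phi> \<in> F P Q" "\<psi> \<in> F Q P"
    "compose P \<psi> \<phi> = (\<lambda>x\<in>P. x)" "compose Q \<phi> \<psi> = (\<lambda>x\<in>Q. x)"
    by (auto simp: isos_def)
  have "\<psi> (\<phi> x) = x" if "x \<in> P" for x
    using fun_cong[OF a(3), of x] that by (simp add: compose_def)
  moreover have "\<phi> (\<psi> x) = x" if "x \<in> Q" for x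
    using fun_cong[OF a(4), of x] that by (simp add: compose_def)
  ultimately show ?thesis using a(1,2) by (intro bij_betwI[of _ _ _ \<psi>]) (auto dest: hom_into)
qed

lemma iso_inverse:
  assumes "\<phi> \<in> F P Q" "\<phi> ` P = Q"
  shows "(\<lambda>x\<in>Q. inv_into P \<phi> x) \<in> F Q P"
proof -
  obtain R \<chi> where R: "subgroup R S" "R \<subseteq> Q" "\<chi> \<in> isos F P R" "\<phi> = compose P (\<lambda>x\<in>R. x) \<chi>"
    using factorization[OF assms(1)] by blast
  have bij: "bij_betw \<chi> P R" using iso_bij R(3) .
  have "\<chi> \<in> F P R" using R(3) by (auto simp: isos_def)
  then have "\<chi> \<in> extensional P" by (rule hom_ext)
  then have "\<phi> = \<chi>"
    using bij unfolding R(4) by (auto simp: compose_def bij_betw_def extensional_def)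
  then have RQ: "R = Q" using bij assms(2) by (auto simp: bij_betw_def)
  obtain \<psi> where psi: "\<psi> \<in> F Q P" "compose P \<psi> \<phi> = (\<lambda>x\<in>P. x)"
    using R(3) RQ \<open>\<phi> = \<chi>\<close> by (auto simp: isos_def)
  have "\<psi> x = inv_into P \<phi> x" if x: "x \<in> Q" for x
  proof -
    obtain y where y: "y \<in> P" "x = \<phi> y" using x assms(2) by auto
    have "\<psi> (\<phi> y) = y" using fun_cong[OF psi(2), of y] y by (simp add: compose_def)
    then show ?thesis using y hom_inj[OF assms(1)] by simp
  qed
  then have "\<psi> = (\<lambda>x\<in>Q. inv_into P \<phi> x)"
    using hom_ext[OF psi(1)] by (auto simp: fun_eq_iff extensional_def)
  with psi show ?thesis by simp
qed

lemma Aut_group_subgroup: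
  assumes "subgroup P S"
  shows "subgroup (F P P) (BijGroup P)"
proof
  show "F P P \<subseteq> carrier (BijGroup P)" using endo_Bij by (simp add: BijGroup_def)
  show "\<phi> \<otimes>\<^bsub>BijGroup P\<^esub> \<psi> \<in> F P P" if "\<phi> \<in> F P P" "\<psi> \<in> F P P" for \<phi> \<psi>
    using that endo_Bij composition by (auto simp: BijGroup_def subset_iff)
  show "\<one>\<^bsub>BijGroup P\<^esub> \<in> F P P" using identity[OF assms assms] by (simp add: BijGroup_def)
  show "inv\<^bsub>BijGroup P\<^esub> \<phi> \<in> F P P" if "\<phi> \<in> F P P" for \<phi>
  proof -
    have "\<phi> \<in> Bij P" using that endo_Bij by blast
    then show ?thesis using that iso_inverse[OF that] by (auto simp: inv_BijGroup Bij_def bij_betw_def)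
  qed
qed

lemma group_Aut_group: "subgroup P S \<Longrightarrow> group (Aut_group F P)"
  unfolding Aut_group_def
  by (rule subgroup.subgroup_is_group[OF Aut_group_subgroup group_BijGroup])

lemma fusion_system_normalizer_fusion: "fusion_system S p (normalizer_fusion S F)"
proof
  let ?N = "normalizer_fusion S F" and ?C = "carrier S"
  fix P Q R \<phi> \<psi>
  show "inner_fusion S P Q \<subseteq> ?N P Q"
  proof
    fix \<theta> assume a: "\<theta> \<in> inner_fusion S P Q"
    then obtain g where g: "g \<in> ?C" "\<theta> = conj_map S P g" and P: "subgroup P S"
      by (auto simp: inner_fusion_def)
    have "conj_map S ?C g \<in> F ?C ?C"
      using inner_le[of ?C ?C] g(1) subgroup_self by (fastforce simp: inner_fusion_def conj_map_def)
    moreover have "restrict (conj_map S ?C g) P = \<theta>"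
      using g(2) subgroup.mem_carrier[OF P] by (auto simp: conj_map_def)
    ultimately show "\<theta> \<in> ?N P Q" using a inner_le by (auto simp: normalizer_fusion_def)
  qed
  assume phi: "\<phi> \<in> ?N P Q"
  then obtain \<alpha> where \<alpha>: "\<alpha> \<in> F ?C ?C" "restrict \<alpha> P = \<phi>" and F: "\<phi> \<in> F P Q"
    by (auto simp: normalizer_fusion_def)
  show "subgroup P S \<and> subgroup Q S" using objects F .
  then have P: "subgroup P S" and PC: "P \<subseteq> ?C" by (auto dest: subgroup.subset)
  show "\<phi> \<in> mon (S\<lparr>carrier := P\<rparr>) (S\<lparr>carrier := Q\<rparr>) \<inter> extensional P" using injective_hom F .
  show "compose P \<psi> \<phi> \<in> ?N P R" if psi: "\<psi> \<in> ?N Q R"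
  proof -
    obtain \<beta> where \<beta>: "\<beta> \<in> F ?C ?C" "restrict \<beta> Q = \<psi>" and F': "\<psi> \<in> F Q R"
      using psi by (auto simp: normalizer_fusion_def)
    have "restrict (compose ?C \<beta> \<alpha>) P = compose P \<psi> \<phi>"
      using hom_into[OF F] PC unfolding \<alpha>(2)[symmetric] \<beta>(2)[symmetric]
      by (auto simp: compose_def fun_eq_iff)
    then show ?thesis
      using composition[OF F F'] composition[OF \<alpha>(1) \<beta>(1)] by (auto simp: normalizer_fusion_def)
  qed
  show "\<exists>R \<chi>. subgroup R S \<and> R \<subseteq> Q \<and> \<chi> \<in> isos ?N P R \<and> \<phi> = compose P (\<lambda>x\<in>R. x) \<chi>"
  proof -
    obtain R \<chi> where R: "subgroup R S" "R \<subseteq> Q" "\<chi> \<in> isos F P R" "\<phi> = compose P (\<lambda>x\<in>R. x) \<chi>"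
      using factorization[OF F] by blast
    have bij: "bij_betw \<chi> P R" using iso_bij R(3) .
    have \<chi>: "\<chi> \<in> F P R" using R(3) by (auto simp: isos_def)
    then have "\<chi> \<in> extensional P" by (rule hom_ext)
    then have eq: "\<phi> = \<chi>"
      using bij unfolding R(4) by (auto simp: compose_def bij_betw_def extensional_def)
    obtain \<theta> where \<theta>: "\<theta> \<in> F R P" "compose P \<theta> \<chi> = (\<lambda>x\<in>P. x)" "compose R \<chi> \<theta> = (\<lambda>x\<in>R. x)"
      using R(3) by (auto simp: isos_def)
    have \<alpha>C: "\<alpha> ` ?C = ?C" using subsetD[OF endo_Bij \<alpha>(1)] by (simp add: Bij_def bij_betw_def)
    have "restrict (\<lambda>x\<in>?C. inv_into ?C \<alpha> x) R = \<theta>"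
    proof
      fix x
      show "restrict (\<lambda>x\<in>?C. inv_into ?C \<alpha> x) R x = \<theta> x"
      proof (cases "x \<in> R")
        case True
        then have "\<theta> x \<in> P" "\<chi> (\<theta> x) = x"
          using hom_into[OF \<theta>(1)] fun_cong[OF \<theta>(3), of x] by (auto simp: compose_def)
        then have "\<alpha> (\<theta> x) = x" using \<alpha>(2) eq by (metis restrict_apply')
        then have "inv_into ?C \<alpha> x = \<theta> x"
          using hom_inj[OF \<alpha>(1)] \<open>\<theta> x \<in> P\<close> PC by (metis inv_into_f_f subsetD)
        then show ?thesis using True subgroup.mem_carrier[OF R(1)] by simp
      next
        case False
        then show ?thesis using hom_ext[OF \<theta>(1)] by (simp add: extensional_def)
      qed
    qed
    then have "\<theta> \<in> ?N R P"
      using \<theta>(1) iso_inverse[OF \<alpha>(1) \<alpha>C] unfolding normalizer_fusion_def by blast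
    moreover have "\<chi> \<in> ?N P R"
      using \<chi> \<alpha> eq by (auto simp: normalizer_fusion_def)
    ultimately show ?thesis using R \<theta> unfolding isos_def by blast
  qed
qed

end

lemma inner_fusionI:
  assumes "subgroup P S" "subgroup Q S" "g \<in> carrier S" "conj_map S P g ` P \<subseteq> Q"
  shows "conj_map S P g \<in> inner_fusion S P Q"
  using assms by (auto simp: inner_fusion_def)

lemma (in finite_p_group) fusion_system_inner_fusion: "fusion_system S p (inner_fusion S)"
proof
  let ?I = "inner_fusion S"
  fix P Q R \<phi> \<psi>
  show "?I P Q \<subseteq> ?I P Q" by simp
  assume phi: "\<phi> \<in> ?I P Q"
  then obtain g where g: "g \<in> carrier S" "\<phi> = conj_map S P g" "\<phi> ` P \<subseteq> Q"
    and P: "subgroup P S" and Q: "subgroup Q S"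
    by (auto simp: inner_fusion_def)
  note memP = subgroup.mem_carrier[OF P]
  show "subgroup P S \<and> subgroup Q S" using P Q by simp
  have hom: "\<phi> (x \<otimes> y) = \<phi> x \<otimes> \<phi> y" if "x \<in> P" "y \<in> P" for x y
    using that memP g(1) subgroup.m_closed[OF P] by (simp add: g(2) conj_map_def m_assoc inv_solve_left)
  have inj: "inj_on \<phi> P"
    using memP g(1) by (auto simp: inj_on_def g(2) conj_map_def)
  show "\<phi> \<in> mon (S\<lparr>carrier := P\<rparr>) (S\<lparr>carrier := Q\<rparr>) \<inter> extensional P"
    using hom inj g(3) by (auto simp: mon_def hom_def g(2) conj_map_def)
  show "compose P \<psi> \<phi> \<in> ?I P R" if psi: "\<psi> \<in> ?I Q R"
  proof -
    obtain h where h: "h \<in> carrier S" "\<psi> = conj_map S Q h" "\<psi> ` Q \<subseteq> R" and R: "subgroup R S"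
      using psi by (auto simp: inner_fusion_def)
    have "compose P \<psi> \<phi> x = conj_map S P (h \<otimes> g) x" for x
    proof (cases "x \<in> P")
      case True
      then have "\<phi> x \<in> Q" using g(3) by blast
      then show ?thesis using True memP[OF True] g(1) h(1)
        by (simp add: compose_def g(2) h(2) conj_map_def inv_mult_group m_assoc)
    qed (simp add: compose_def conj_map_def)
    then have eq: "compose P \<psi> \<phi> = conj_map S P (h \<otimes> g)" by blast
    have "compose P \<psi> \<phi> ` P \<subseteq> R" using g(3) h(3) by (auto simp: compose_def)
    then show ?thesis
      unfolding eq using inner_fusionI[OF P R m_closed[OF h(1) g(1)]] by simp
  qed
  show "\<exists>R \<chi>. subgroup R S \<and> R \<subseteq> Q \<and> \<chi> \<in> isos ?I P R \<and> \<phi> = compose P (\<lambda>x\<in>R. x) \<chi>"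
  proof (intro exI conjI)
    interpret phi: group_hom "S\<lparr>carrier := P\<rparr>" S \<phi>
      using hom g(3) subgroup.subset[OF Q] subgroup.subgroup_is_group[OF P] 
      by (intro group_hom.intro group_hom_axioms.intro) (auto simp: hom_def is_group)
    let ?R = "\<phi> ` P"
    show R: "subgroup ?R S" using phi.img_is_subgroup by simp
    show "?R \<subseteq> Q" by (rule g(3))
    have undo_g: "conj_map S ?R (inv g) (\<phi> x) = x" if "x \<in> P" for x
    proof -
      have "conj_map S ?R (inv g) (\<phi> x) = inv g \<otimes> \<phi> x \<otimes> g"
        using that g(1) by (simp add: conj_map_def)
      also have "\<dots> = x"
        using that memP[OF that] g(1) m_assoc[of "inv g" g x, symmetric]
        by (simp add: g(2) conj_map_def m_assoc)
      finally show ?thesis .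
    qed
    have "\<phi> \<in> ?I P ?R"
      using inner_fusionI[OF P R g(1)] unfolding g(2)[symmetric] by blast
    moreover have "conj_map S ?R (inv g) ` ?R \<subseteq> P" using undo_g by auto
    then have "conj_map S ?R (inv g) \<in> ?I ?R P"
      by (rule inner_fusionI[OF R P inv_closed[OF g(1)]])
    moreover have "compose P (conj_map S ?R (inv g)) \<phi> = (\<lambda>x\<in>P. x)"
      using undo_g by (auto simp: compose_def)
    moreover have "compose ?R \<phi> (conj_map S ?R (inv g)) = (\<lambda>x\<in>?R. x)"
      unfolding compose_def by (rule restrict_ext) (auto simp: undo_g)
    ultimately show "\<phi> \<in> isos ?I P ?R" unfolding isos_def by blast
    show "\<phi> = compose P (\<lambda>x\<in>?R. x) \<phi>"
      by (auto simp: compose_def g(2) conj_map_def)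
  qed
qed

end

theory Submission
  imports Defs "HOL-Algebra.Multiplicative_Group" "HOL-Algebra.Sylow"
begin

text \<open>
  The heart of the proof is a statement about one subgroup \<open>P\<close> of \<open>S\<close> and the finite group
  \<open>A = Aut\<^sub>F(P)\<close>. Let \<open>T \<subseteq> A\<close> be such that the elements of \<open>T\<close> act on cyclic subgroups of order
  \<open>p\<close> or \<open>4\<close> of the hyperfocal subgroup like conjugations in \<open>S\<close>, and let \<open>B\<close> be the normal
  closure of \<open>T\<close> in \<open>A\<close>. If all morphisms between such cyclic subgroups extend to \<open>S\<close>, then \<open>B\<close>
  is a \<open>p\<close>-group (\<open>normal_closure_p_group\<close>).

  To see this, let \<open>L\<close> be the set of elements of \<open>B\<close> of order prime to \<open>p\<close>; it has to be trivial.
  These elements lie in \<open>O\<^sup>p(A)\<close>, so \<open>W = [P, L]\<close> is contained in the hyperfocal subgroup, and as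
  the action is coprime it is enough that \<open>L\<close> fixes \<open>W\<close> pointwise. Otherwise choose a minimal
  \<open>A\<close>-invariant subgroup \<open>X\<close> of \<open>W\<close> on which \<open>L\<close> acts nontrivially, with fixed points \<open>K\<close>. Every
  proper invariant subgroup of \<open>X\<close> lies in \<open>K\<close>, which forces \<open>K\<close> to be central in \<open>X\<close>, \<open>X / K\<close> to be
  elementary abelian, and \<open>X\<close> to have exponent \<open>p\<close>, or \<open>4\<close> if \<open>p = 2\<close>. This is the classical
  argument by which a coprime automorphism is trivial if it fixes the elements of order \<open>p\<close> and
  \<open>4\<close>. The hypothesis now speaks about all elements of \<open>X\<close>. Take a normal subgroup \<open>E\<close> of \<open>S\<close>, invariant
  under \<open>Aut\<^sub>F(S)\<close> and maximal subject to \<open>X\<close> not being contained in \<open>E\<close>. As morphisms on \<open>X\<close> are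
  pointwise given by \<open>Aut\<^sub>F(S)\<close>, the intersection \<open>X \<inter> E\<close> is invariant under \<open>A\<close>, hence contained in
  \<open>K\<close>. By maximality \<open>X\<close> is central modulo \<open>E\<close> in \<open>S\<close>, so \<open>T\<close> acts trivially on \<open>X / K\<close>. Then
  so do \<open>B\<close> and \<open>L\<close>, and \<open>L\<close> acts trivially on \<open>X\<close>, a contradiction.

  For \<open>T = Aut\<^sub>S(P)\<close> this shows that \<open>Aut\<^sub>S(P)\<close> is normal in \<open>Aut\<^sub>F(P)\<close> whenever it is a Sylow
  subgroup. Under this condition \<open>N\<^sub>\<phi>\<close> is always the full normalizer, so morphisms extend step by
  step, and every morphism is a restriction of an element of \<open>Aut\<^sub>F(S)\<close>
  (\<open>extends_if_sylow_normal\<close>). This settles the case of the normalizer of \<open>S\<close>. In the case of the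
  fusion system of \<open>S\<close> over itself, the choice \<open>P = S\<close> and \<open>T = Aut\<^sub>F(S)\<close> shows in addition that
  \<open>Aut\<^sub>F(S)\<close> is a \<open>p\<close>-group, hence equal to its Sylow subgroup \<open>Aut\<^sub>S(S)\<close>.
\<close>

section \<open>Powers and normal closures\<close>

text \<open>
  By Bezout, \<open>x\<close> is a product of powers of \<open>x [^] m\<close> and \<open>x [^] n\<close>. This is used to place elements
  of order prime to \<open>p\<close> in normal subgroups of \<open>p\<close>-power index, elements of \<open>p\<close>-power order in normal
  subgroups of index prime to \<open>p\<close>, and with \<open>N\<close> trivial to show that \<open>x\<close> is the unit.
\<close>

lemma (in group) coprime_powers_mem:
  fixes m n :: nat
  assumes N: "subgroup N G" and x: "x \<in> carrier G"
    and m: "x [^] m \<in> N" and n: "x [^] n \<in> N" and co: "coprime m n"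
  shows "x \<in> N"
proof (cases "m = 0")
  case True
  then have "n = 1" using co by simp
  then show ?thesis using n x by simp
next
  case False
  then obtain a b where ab: "m * a = n * b + 1"
    using bezout_nat[of m n] co by auto
  have pow: "y [^] (k::nat) \<in> N" if "y \<in> N" for y k
    using that N by (induction k) (auto simp: subgroup.one_closed subgroup.m_closed)
  have "x [^] (n * b) \<otimes> x = x [^] (m * a)" using ab by simp
  then have "x = inv (x [^] (n * b)) \<otimes> x [^] (m * a)"
    using x by (metis inv_solve_left nat_pow_closed)
  moreover have "x [^] (n * b) \<in> N" "x [^] (m * a) \<in> N"
    using pow[OF m, of a] pow[OF n, of b] x by (simp_all add: nat_pow_pow)
  ultimately show ?thesis
    using N subgroup.m_closed subgroup.m_inv_closed by metis
qed

text \<open>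
  Lagrange's theorem in the quotient by \<open>N\<close>.
\<close>

lemma (in group) index_power_mem:
  assumes N: "N \<lhd> G" and x: "x \<in> carrier G"
  shows "x [^] card (rcosets N) \<in> N"
proof -
  interpret Q: group "G Mod N" using N by (rule normal.factorgroup_is_group)
  interpret h: group_hom G "G Mod N" "(#>) N"
    by unfold_locales (rule normal.r_coset_hom_Mod[OF N])
  have "N #> (x [^] card (rcosets N)) = (N #> x) [^]\<^bsub>G Mod N\<^esub> order (G Mod N)"
    using h.hom_nat_pow[OF x] by (simp add: order_def FactGroup_def)
  also have "\<dots> = \<one>\<^bsub>G Mod N\<^esub>" using Q.pow_order_eq_1 h.hom_closed[OF x] by blast
  also have "\<dots> = N" by (simp add: FactGroup_def)
  finally have "N #> (x [^] card (rcosets N)) = N" .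
  then show ?thesis using coset_join1 normal_invE(1)[OF N] x nat_pow_closed by blast
qed

text \<open>
  Cauchy's theorem: another prime divisor of the order would produce an element of that prime order.
\<close>

lemma (in group) prime_power_order_if_no_coprime_order:
  assumes p: "prime (p :: nat)" and fin: "finite (carrier G)"
    and triv: "\<And>x n. x \<in> carrier G \<Longrightarrow> coprime n p \<Longrightarrow> x [^] n = \<one> \<Longrightarrow> x = \<one>"
  shows "\<exists>k. order G = p ^ k"
proof -
  have "order G \<noteq> 0" using fin order_gt_0_iff_finite by simp
  then obtain m where m: "order G = p ^ multiplicity p (order G) * m" "\<not> p dvd m"
    using multiplicity_decompose'[of "order G" p] p by (metis not_prime_unit)
  have "m = 1"
  proof (rule ccontr)
    assume "m \<noteq> 1"
    then obtain q where q: "prime q" "q dvd m" using prime_factor_nat by blast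
    then obtain m' where "order G = q ^ 1 * m'"
      using m(1) by (metis dvd_def dvd_mult power_one_right)
    then obtain H where H: "subgroup H G" "card H = q ^ 1"
      using sylow_thm[OF q(1) is_group _ fin] by blast
    interpret H: group "G\<lparr>carrier := H\<rparr>" using H(1) by (rule subgroup.subgroup_is_group[OF _ is_group])
    have "card H \<noteq> 1" using H(2) q(1) by auto
    moreover have "\<one> \<in> H" using subgroup.one_closed[OF H(1)] .
    ultimately obtain h where h: "h \<in> H" "h \<noteq> \<one>"
      by (metis is_singletonI' is_singleton_altdef empty_iff)
    have "h [^]\<^bsub>G\<lparr>carrier := H\<rparr>\<^esub> q = \<one>"
      using H.pow_order_eq_1[of h] h(1) H(2) by (simp add: order_def)
    then have "h [^] q = \<one>" by (simp add: nat_pow_consistent[symmetric])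
    moreover have "coprime q p" using q m(2) p primes_coprime by blast
    ultimately show False using triv h subgroup.mem_carrier[OF H(1)] by blast
  qed
  then show ?thesis using m(1) by auto
qed

lemma (in group) conj_pow:
  assumes "a \<in> carrier G" "x \<in> carrier G"
  shows "(a \<otimes> x \<otimes> inv a) [^] (n :: nat) = a \<otimes> x [^] n \<otimes> inv a"
proof (induction n)
  case (Suc n)
  have "inv a \<otimes> (a \<otimes> (x \<otimes> inv a)) = x \<otimes> inv a"
    using assms m_assoc[of "inv a" a "x \<otimes> inv a", symmetric] by simp
  then have "(a \<otimes> x [^] n \<otimes> inv a) \<otimes> (a \<otimes> x \<otimes> inv a) = a \<otimes> x [^] Suc n \<otimes> inv a"
    using assms by (simp add: m_assoc)
  then show ?case using Suc by simp
qed (use assms in simp)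

text \<open>
  The power formula in a group of class two: moving one factor \<open>x\<close> to the left past \<open>y [^] n\<close> costs
  \<open>c [^] n\<close>, and these costs add up to a binomial coefficient.
\<close>

lemma (in group) mult_pow_central_commutator:
  assumes G: "x \<in> carrier G" "y \<in> carrier G" "c \<in> carrier G"
    and yx: "y \<otimes> x = x \<otimes> y \<otimes> c" and cx: "c \<otimes> x = x \<otimes> c" and cy: "c \<otimes> y = y \<otimes> c"
  shows "y [^] n \<otimes> x = x \<otimes> y [^] n \<otimes> c [^] (n :: nat)"
    and "(x \<otimes> y) [^] n = x [^] n \<otimes> y [^] n \<otimes> c [^] (n choose 2)"
proof -
  have com: "c [^] (k::nat) \<otimes> z = z \<otimes> c [^] k" if "c \<otimes> z = z \<otimes> c" "z \<in> carrier G" for k z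
    using group_commutes_pow[of c z k] that G by blast
  show swap: "y [^] n \<otimes> x = x \<otimes> y [^] n \<otimes> c [^] n" for n :: nat
  proof (induction n)
    case 0
    then show ?case using G by simp
  next
    case (Suc n)
    have "y [^] Suc n \<otimes> x = y [^] n \<otimes> (y \<otimes> x)" using G by (simp add: m_assoc)
    also have "\<dots> = (y [^] n \<otimes> x) \<otimes> y \<otimes> c" using G by (simp add: yx m_assoc)
    also have "\<dots> = x \<otimes> y [^] n \<otimes> (c [^] n \<otimes> y) \<otimes> c" using G by (simp add: Suc m_assoc)
    also have "\<dots> = x \<otimes> y [^] Suc n \<otimes> c [^] Suc n" using G by (simp add: com[OF cy] m_assoc)
    finally show ?case .
  qed
  show "(x \<otimes> y) [^] n = x [^] n \<otimes> y [^] n \<otimes> c [^] (n choose 2)"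
  proof (induction n)
    case 0
    then show ?case using G by (simp add: numeral_2_eq_2)
  next
    case (Suc n)
    let ?t = "n choose 2"
    have "(x \<otimes> y) [^] Suc n = x [^] n \<otimes> y [^] n \<otimes> (c [^] ?t \<otimes> x) \<otimes> y"
      using G Suc by (simp add: m_assoc)
    also have "\<dots> = x [^] n \<otimes> (y [^] n \<otimes> x) \<otimes> (c [^] ?t \<otimes> y)"
      using G by (simp add: com[OF cx] m_assoc)
    also have "c [^] ?t \<otimes> y = y \<otimes> c [^] ?t" by (rule com[OF cy G(2)])
    also have "x [^] n \<otimes> (y [^] n \<otimes> x) \<otimes> (y \<otimes> c [^] ?t) =
        x [^] n \<otimes> x \<otimes> y [^] n \<otimes> (c [^] n \<otimes> y) \<otimes> c [^] ?t"
      using G by (simp add: swap m_assoc)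
    also have "c [^] n \<otimes> y = y \<otimes> c [^] n" by (rule com[OF cy G(2)])
    also have "x [^] n \<otimes> x \<otimes> y [^] n \<otimes> (y \<otimes> c [^] n) \<otimes> c [^] ?t =
        x [^] Suc n \<otimes> y [^] Suc n \<otimes> (c [^] n \<otimes> c [^] ?t)"
      using G by (simp add: m_assoc)
    also have "c [^] n \<otimes> c [^] ?t = c [^] (Suc n choose 2)"
      using G by (simp add: nat_pow_mult numeral_2_eq_2)
    finally show ?case .
  qed
qed

definition normal_closure :: "('a, 'b) monoid_scheme \<Rightarrow> 'a set \<Rightarrow> 'a set" where
  "normal_closure G T = \<Inter>{N. N \<lhd> G \<and> T \<subseteq> N}"

lemma (in group) normal_closure:
  assumes "T \<subseteq> carrier G"
  shows "normal_closure G T \<lhd> G" "T \<subseteq> normal_closure G T"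
    "N \<lhd> G \<Longrightarrow> T \<subseteq> N \<Longrightarrow> normal_closure G T \<subseteq> N"
proof -
  let ?A = "{N. N \<lhd> G \<and> T \<subseteq> N}"
  have "carrier G \<in> ?A" using normal_self assms by simp
  then have "subgroup (\<Inter>?A) G"
    using normal_invE(1) by (intro subgroups_Inter) auto
  then show "normal_closure G T \<lhd> G"
    unfolding normal_closure_def normal_inv_iff using normal_invE(2) by auto
qed (auto simp: normal_closure_def)

section \<open>Centres and normalizers in finite p-groups\<close>

text \<open>
  The class equation: if only the unit were central, all other conjugacy classes would have size
  divisible by \<open>p\<close>, so that the group order would be \<open>1\<close> modulo \<open>p\<close>.
\<close>

lemma (in finite_p_group) nontrivial_center:
  assumes "carrier S \<noteq> {\<one>}"
  shows "\<exists>z \<in> carrier S. z \<noteq> \<one> \<and> (\<forall>y \<in> carrier S. y \<otimes> z \<otimes> inv y = z)"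
proof (rule ccontr)
  assume none: "\<not> ?thesis"
  let ?\<phi> = "\<lambda>g. \<lambda>h \<in> carrier S. g \<otimes> h \<otimes> inv g"
  interpret conj: group_action S "carrier S" ?\<phi> by (rule action_by_conjugation)
  let ?O = "orbits S (carrier S) ?\<phi>"
  interpret part: partition "carrier S" ?O by (rule conj.orbit_partition)
  have orbit_one: "orbit S ?\<phi> \<one> = {\<one>}"
    by (auto simp: orbit_def intro!: exI[of _ \<one>])
  have orbit_dvd: "p dvd card B" if B: "B \<in> ?O - {{\<one>}}" for B
  proof -
    obtain x where x: "x \<in> carrier S" "B = orbit S ?\<phi> x" using B by (auto simp: orbits_def)
    have "x \<noteq> \<one>" using B x orbit_one by auto
    then obtain y where y: "y \<in> carrier S" "y \<otimes> x \<otimes> inv y \<noteq> x" using none x by blast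
    then have "y \<otimes> x \<otimes> inv y \<in> B" unfolding x(2) orbit_def using x(1) by fastforce
    moreover have "x \<in> B" using conj.orbit_refl x by blast
    ultimately have "card B \<noteq> 1" using y(2) by (metis card_1_singletonE singletonD)
    have "card B dvd order S"
      unfolding x(2) conj.orbit_stabilizer_theorem[OF x(1), symmetric] by (rule dvd_triv_left)
    then obtain i where "card B = p ^ i"
      using p_power_order prime divides_primepow_nat by metis
    with \<open>card B \<noteq> 1\<close> show ?thesis by (cases i) auto
  qed
  have finO: "finite ?O"
    using finite_carrier by (auto simp: orbits_def)
  have "{\<one>} \<in> ?O" using orbit_one by (force simp: orbits_def)
  have "order S = (\<Sum>B \<in> ?O. card B)"
    using part.disjoint_sum[OF finite_carrier, of "\<lambda>_. 1 :: nat"] by (simp add: order_def)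
  also have "\<dots> = 1 + (\<Sum>B \<in> ?O - {{\<one>}}. card B)"
    using sum.remove[OF finO \<open>{\<one>} \<in> ?O\<close>, of card] by simp
  finally have "order S = 1 + (\<Sum>B \<in> ?O - {{\<one>}}. card B)" .
  moreover have "p dvd (\<Sum>B \<in> ?O - {{\<one>}}. card B)" by (rule dvd_sum) (rule orbit_dvd)
  moreover have "p dvd order S"
  proof -
    obtain n where n: "order S = p ^ n" using p_power_order by blast
    have "order S \<noteq> 1" using assms order_one_triv_iff finite_carrier by blast
    then show ?thesis using n by (cases n) auto
  qed
  ultimately have "p dvd 1"
    using dvd_add_left_iff[of p "\<Sum>B \<in> ?O - {{\<one>}}. card B" 1] by (simp only:)
  then show False using prime by (simp add: prime_nat_iff)
qed

text \<open>
  For normal \<open>N\<close>, the preimage in \<open>G\<close> of the centre of \<open>G / N\<close>.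
\<close>

definition center_mod :: "('a, 'b) monoid_scheme \<Rightarrow> 'a set \<Rightarrow> 'a set" where
  "center_mod G N =
     {x \<in> carrier G. \<forall>y \<in> carrier G. inv\<^bsub>G\<^esub> x \<otimes>\<^bsub>G\<^esub> (y \<otimes>\<^bsub>G\<^esub> x \<otimes>\<^bsub>G\<^esub> inv\<^bsub>G\<^esub> y) \<in> N}"

lemma (in group) center_mod_normal:
  assumes N: "N \<lhd> G"
  shows "N \<subseteq> center_mod G N" "center_mod G N \<lhd> G"
proof -
  note sN = normal_invE(1)[OF N] and cN = normal_invE(2)[OF N]
  note memN = subgroup.mem_carrier[OF sN]
  show sub: "N \<subseteq> center_mod G N"
    using memN cN subgroup.m_closed[OF sN] subgroup.m_inv_closed[OF sN]
    by (auto simp: center_mod_def)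
  have sub_cm: "subgroup (center_mod G N) G"
  proof
    show "center_mod G N \<subseteq> carrier G" by (auto simp: center_mod_def)
    show "\<one> \<in> center_mod G N" using sub subgroup.one_closed[OF sN] by blast
  next
    fix a b assume a: "a \<in> center_mod G N" and b: "b \<in> center_mod G N"
    then have ab: "a \<in> carrier G" "b \<in> carrier G" by (auto simp: center_mod_def)
    have "inv (a \<otimes> b) \<otimes> (y \<otimes> (a \<otimes> b) \<otimes> inv y) \<in> N" if y: "y \<in> carrier G" for y
    proof -
      let ?n = "inv a \<otimes> (y \<otimes> a \<otimes> inv y)" and ?m = "inv b \<otimes> (y \<otimes> b \<otimes> inv y)"
      have n: "?n \<in> N" "?m \<in> N" using a b y by (auto simp: center_mod_def)
      have "inv b \<otimes> ?n \<otimes> b \<in> N" using cN[OF inv_closed[OF ab(2)] n(1)] ab by simp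
      then have "(inv b \<otimes> ?n \<otimes> b) \<otimes> ?m \<in> N" using n(2) by (rule subgroup.m_closed[OF sN])
      moreover have "(inv b \<otimes> ?n \<otimes> b) \<otimes> ?m = inv (a \<otimes> b) \<otimes> (y \<otimes> (a \<otimes> b) \<otimes> inv y)"
      proof -
        have "u \<otimes> (inv u \<otimes> v) = v" "inv u \<otimes> (u \<otimes> v) = v" if "u \<in> carrier G" "v \<in> carrier G" for u v
          using that by (simp_all flip: m_assoc)
        then show ?thesis using ab y by (simp add: m_assoc inv_mult_group)
      qed
      ultimately show ?thesis by (simp only:)
    qed
    then show "a \<otimes> b \<in> center_mod G N" using ab by (simp add: center_mod_def)
  next
    fix a assume a: "a \<in> center_mod G N"
    then have aG: "a \<in> carrier G" by (auto simp: center_mod_def)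
    have "inv (inv a) \<otimes> (y \<otimes> inv a \<otimes> inv y) \<in> N" if y: "y \<in> carrier G" for y
    proof -
      let ?n = "inv a \<otimes> (y \<otimes> a \<otimes> inv y)"
      have n: "?n \<in> N" using a y by (auto simp: center_mod_def)
      have "a \<otimes> inv ?n \<otimes> inv a \<in> N" using cN[OF aG] n subgroup.m_inv_closed[OF sN] by blast
      moreover have "a \<otimes> inv ?n \<otimes> inv a = inv (inv a) \<otimes> (y \<otimes> inv a \<otimes> inv y)"
        using aG y by (simp add: m_assoc inv_mult_group)
      ultimately show ?thesis by (simp only:)
    qed
    then show "inv a \<in> center_mod G N" using aG by (simp add: center_mod_def)
  qed
  show "center_mod G N \<lhd> G"
    unfolding normal_inv_iff
  proof (intro conjI ballI sub_cm)
    fix g x assume g: "g \<in> carrier G" and x: "x \<in> center_mod G N"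
    then have "x \<in> carrier G" "inv x \<otimes> (g \<otimes> x \<otimes> inv g) \<in> N" by (auto simp: center_mod_def)
    moreover have "x \<otimes> (inv x \<otimes> (g \<otimes> x \<otimes> inv g)) = g \<otimes> x \<otimes> inv g"
      using g \<open>x \<in> carrier G\<close> by (simp flip: m_assoc)
    ultimately show "g \<otimes> x \<otimes> inv g \<in> center_mod G N"
      using subgroup.m_closed[OF sub_cm x, of "inv x \<otimes> (g \<otimes> x \<otimes> inv g)"] sub by auto
  qed
qed

lemma (in finite_p_group) finite_p_group_quotient:
  assumes N: "N \<lhd> S"
  shows "finite_p_group (S Mod N) p"
proof -
  interpret Q: group "S Mod N" using N by (rule normal.factorgroup_is_group)
  have lag: "card (rcosets N) * card N = order S" using lagrange normal_invE(1)[OF N] by blast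
  have "card (rcosets N) dvd order S" using lag by (metis dvd_triv_left)
  then obtain k where k: "card (rcosets N) = p ^ k"
    using p_power_order prime divides_primepow_nat by metis
  then have "card (rcosets N) > 0" using prime prime_gt_0_nat by simp
  then show ?thesis
    using k prime by unfold_locales (auto simp: FactGroup_def order_def card_ge_0_finite)
qed

lemma (in finite_p_group) finite_p_group_subgroup:
  assumes "subgroup H S"
  shows "finite_p_group (S\<lparr>carrier := H\<rparr>) p"
proof -
  interpret H: group "S\<lparr>carrier := H\<rparr>" using assms by (rule subgroup.subgroup_is_group[OF _ is_group])
  have "card H dvd order S" using lagrange[OF assms] by (metis dvd_triv_right)
  then have "\<exists>k. card H = p ^ k" using p_power_order prime divides_primepow_nat by metis
  then show ?thesis
    using prime finite_subset[OF subgroup.subset[OF assms] finite_carrier]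
    by unfold_locales (auto simp: order_def)
qed

lemma (in finite_p_group) center_mod_grows:
  assumes N: "N \<lhd> S" and ne: "N \<noteq> carrier S"
  shows "\<exists>x \<in> center_mod S N. x \<notin> N"
proof -
  note sN = normal_invE(1)[OF N]
  let ?Q = "S Mod N"
  interpret Q: finite_p_group ?Q p using finite_p_group_quotient[OF N] .
  have hom: "(#>) N \<in> hom S ?Q" using normal.r_coset_hom_Mod[OF N] .
  interpret h: group_hom S ?Q "(#>) N" by unfold_locales (rule hom)
  have one: "\<one>\<^bsub>?Q\<^esub> = N" by (simp add: FactGroup_def)
  have coset: "N #> x = N \<longleftrightarrow> x \<in> N" if "x \<in> carrier S" for x
    using that coset_join1[OF _ that sN] coset_join2[OF that sN] by blast
  have "carrier ?Q \<noteq> {\<one>\<^bsub>?Q\<^esub>}"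
  proof -
    obtain x where x: "x \<in> carrier S" "x \<notin> N" using ne subgroup.subset[OF sN] by blast
    then have "N #> x \<in> carrier ?Q" "N #> x \<noteq> N" using h.hom_closed coset by auto
    then show ?thesis unfolding one by blast
  qed
  then obtain Z where Z: "Z \<in> carrier ?Q" "Z \<noteq> \<one>\<^bsub>?Q\<^esub>"
    "\<And>Y. Y \<in> carrier ?Q \<Longrightarrow> Y \<otimes>\<^bsub>?Q\<^esub> Z \<otimes>\<^bsub>?Q\<^esub> inv\<^bsub>?Q\<^esub> Y = Z"
    using Q.nontrivial_center by blast
  then obtain x where x: "x \<in> carrier S" "Z = N #> x" by (auto simp: FactGroup_def RCOSETS_def)
  have "inv x \<otimes> (y \<otimes> x \<otimes> inv y) \<in> N" if y: "y \<in> carrier S" for y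
  proof -
    have "N #> (inv x \<otimes> (y \<otimes> x \<otimes> inv y)) =
      inv\<^bsub>?Q\<^esub> Z \<otimes>\<^bsub>?Q\<^esub> ((N #> y) \<otimes>\<^bsub>?Q\<^esub> Z \<otimes>\<^bsub>?Q\<^esub> inv\<^bsub>?Q\<^esub> (N #> y))"
      using x y by simp
    also have "(N #> y) \<otimes>\<^bsub>?Q\<^esub> Z \<otimes>\<^bsub>?Q\<^esub> inv\<^bsub>?Q\<^esub> (N #> y) = Z"
      by (rule Z(3)[OF h.hom_closed[OF y]])
    also have "inv\<^bsub>?Q\<^esub> Z \<otimes>\<^bsub>?Q\<^esub> Z = N"
      using Q.l_inv[OF Z(1)] one by (rule trans)
    finally have "N #> (inv x \<otimes> (y \<otimes> x \<otimes> inv y)) = N" .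
    then show ?thesis using coset[of "inv x \<otimes> (y \<otimes> x \<otimes> inv y)"] x(1) y by (simp only: m_closed inv_closed)
  qed
  then have "x \<in> center_mod S N" using x by (simp add: center_mod_def)
  moreover have "x \<notin> N" using Z(2) x coset one by simp
  ultimately show ?thesis by blast
qed

text \<open>
  Let \<open>N\<close> be maximal among the normal subgroups of \<open>S\<close> inside \<open>K\<close>. The preimage of the centre of
  \<open>S / N\<close> is normal and larger than \<open>N\<close>, so it is not contained in \<open>K\<close>; and its elements normalize
  \<open>K\<close>, because they commute with \<open>K\<close> modulo \<open>N\<close>.
\<close>

lemma (in finite_p_group) normalizer_grows:
  assumes K: "subgroup K S" and ne: "K \<noteq> carrier S"
  shows "\<exists>x \<in> carrier S. x \<notin> K \<and> (\<forall>k \<in> K. x \<otimes> k \<otimes> inv x \<in> K)"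
proof -
  note memK = subgroup.mem_carrier[OF K]
  let ?P = "\<lambda>N. N \<lhd> S \<and> N \<subseteq> K"
  have finK: "finite K" using subgroup.subset[OF K] finite_carrier by (rule finite_subset)
  have "?P {\<one>}" using one_is_normal subgroup.one_closed[OF K] by simp
  moreover have "\<forall>N. ?P N \<longrightarrow> card N < Suc (card K)"
    using card_mono[OF finK] less_Suc_eq_le by blast
  ultimately have "\<exists>N. ?P N \<and> (\<forall>M. ?P M \<longrightarrow> card M \<le> card N)"
    by (rule ex_has_greatest_nat[of ?P "{\<one>}" card "Suc (card K)"])
  then obtain N where N: "N \<lhd> S" "N \<subseteq> K" and max: "\<And>M. ?P M \<Longrightarrow> card M \<le> card N"
    by blast
  let ?Y = "center_mod S N"
  have "N \<noteq> carrier S" using N(2) ne subgroup.subset[OF K] by blast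
  then obtain y where y: "y \<in> ?Y" "y \<notin> N" using center_mod_grows[OF N(1)] by blast
  have "\<not> ?Y \<subseteq> K"
  proof
    assume "?Y \<subseteq> K"
    then have "card ?Y \<le> card N" using max center_mod_normal[OF N(1)] by blast
    moreover have "N \<subset> ?Y" using center_mod_normal(1)[OF N(1)] y by blast
    moreover have "finite ?Y" using finK \<open>?Y \<subseteq> K\<close> by (rule rev_finite_subset)
    ultimately show False using psubset_card_mono[of ?Y N] by linarith
  qed
  then obtain x where x: "x \<in> ?Y" "x \<notin> K" by blast
  then have xS: "x \<in> carrier S" by (simp add: center_mod_def)
  have "x \<otimes> k \<otimes> inv x \<in> K" if k: "k \<in> K" for k
  proof -
    \<comment> \<open>\<open>k\<close> commutes with \<open>x\<close> modulo \<open>N \<subseteq> K\<close>\<close>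
    have "inv x \<otimes> (inv k \<otimes> x \<otimes> inv (inv k)) \<in> N"
      using x(1) memK[OF k] unfolding center_mod_def by blast
    then have "x \<otimes> (inv x \<otimes> (inv k \<otimes> x \<otimes> k)) \<otimes> inv x \<in> K"
      using normal_invE(2)[OF N(1) xS] N(2) memK[OF k] by auto
    moreover have "x \<otimes> (inv x \<otimes> (inv k \<otimes> x \<otimes> k)) \<otimes> inv x = inv k \<otimes> (x \<otimes> k \<otimes> inv x)"
      using xS memK[OF k] by (simp add: m_assoc[symmetric])
    ultimately have "k \<otimes> (inv k \<otimes> (x \<otimes> k \<otimes> inv x)) \<in> K"
      using subgroup.m_closed[OF K k] by simp
    then show ?thesis using xS memK[OF k] by (simp add: m_assoc[symmetric])
  qed
  then show ?thesis using x xS by blast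
qed

section \<open>Morphisms and automorphism groups in a fusion system\<close>

context fusion_system
begin

lemma hom_group_hom:
  assumes "\<phi> \<in> F P Q"
  shows "group_hom (S\<lparr>carrier := P\<rparr>) S \<phi>"
proof -
  have P: "subgroup P S" and Q: "subgroup Q S" using objects[OF assms] by auto
  have "\<phi> \<in> hom (S\<lparr>carrier := P\<rparr>) S"
    using injective_hom[OF assms] subgroup.subset[OF Q] by (auto simp: mon_def hom_def)
  then show ?thesis
    using subgroup.subgroup_is_group[OF P is_group] is_group
    by (intro group_hom.intro group_hom_axioms.intro)
qed

lemma hom_carrier: "\<phi> \<in> F P Q \<Longrightarrow> x \<in> P \<Longrightarrow> x \<in> carrier S \<and> \<phi> x \<in> carrier S"
  using objects hom_into subgroup.mem_carrier by meson

lemma hom_mult: "\<phi> \<in> F P Q \<Longrightarrow> x \<in> P \<Longrightarrow> y \<in> P \<Longrightarrow> \<phi> (x \<otimes> y) = \<phi> x \<otimes> \<phi> y"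
  using group_hom.hom_mult[OF hom_group_hom] by fastforce

lemma hom_unit: "\<phi> \<in> F P Q \<Longrightarrow> \<phi> \<one> = \<one>"
  using group_hom.hom_one[OF hom_group_hom] by fastforce

lemma hom_inverse:
  assumes "\<phi> \<in> F P Q" "x \<in> P"
  shows "\<phi> (inv x) = inv (\<phi> x)"
proof -
  have "subgroup P S" using objects assms(1) by blast
  then show ?thesis
    using group_hom.hom_inv[OF hom_group_hom[OF assms(1)], of x] assms(2) by simp
qed

lemma hom_power: "\<phi> \<in> F P Q \<Longrightarrow> x \<in> P \<Longrightarrow> \<phi> (x [^] (n::nat)) = \<phi> x [^] n"
  using group_hom.hom_nat_pow[OF hom_group_hom, of \<phi> P Q x n] by (simp add: nat_pow_def)

text \<open>
  Factorization writes \<open>\<phi>\<close> as an isomorphism onto its image followed by an inclusion; the inclusion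
  can be replaced by the one into \<open>R\<close>.
\<close>

lemma corestrict:
  assumes \<phi>: "\<phi> \<in> F P Q" and R: "subgroup R S" "\<phi> ` P \<subseteq> R"
  shows "\<phi> \<in> F P R"
proof -
  obtain T \<chi> where T: "subgroup T S" "\<chi> \<in> isos F P T" "\<phi> = compose P (\<lambda>x\<in>T. x) \<chi>"
    using factorization[OF \<phi>] by blast
  have \<chi>: "\<chi> \<in> F P T" "\<chi> ` P = T" using T(2) iso_bij by (auto simp: isos_def bij_betw_def)
  have eq: "\<phi> x = \<chi> x" if "x \<in> P" for x
    using that \<chi>(2) unfolding T(3) by (auto simp: compose_eq)
  then have "\<phi> = \<chi>"
    using hom_ext[OF \<phi>] hom_ext[OF \<chi>(1)] by (intro extensionalityI) auto
  moreover have "T \<subseteq> R" using eq \<chi>(2) R(2) by auto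
  ultimately have "compose P (\<lambda>x\<in>T. x) \<phi> \<in> F P R"
    using composition[OF \<chi>(1) identity[OF T(1) R(1)]] by simp
  then show ?thesis using T(3) \<open>\<phi> = \<chi>\<close> by simp
qed

lemma restrict_hom:
  assumes \<phi>: "\<phi> \<in> F P Q" and A: "subgroup A S" "A \<subseteq> P"
  shows "restrict \<phi> A \<in> F A Q"
proof -
  have "subgroup P S" using objects \<phi> by blast
  then have "compose A \<phi> (\<lambda>x\<in>A. x) \<in> F A Q" using composition[OF identity \<phi>] A by blast
  moreover have "compose A \<phi> (\<lambda>x\<in>A. x) = restrict \<phi> A" by (auto simp: compose_def)
  ultimately show ?thesis by simp
qed

lemma isosI:
  assumes "\<phi> \<in> F P Q" "\<phi> ` P = Q"
  shows "\<phi> \<in> isos F P Q"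
proof -
  let ?\<psi> = "\<lambda>x\<in>Q. inv_into P \<phi> x"
  have "?\<psi> \<in> F Q P" using iso_inverse assms .
  moreover have "compose P ?\<psi> \<phi> = (\<lambda>x\<in>P. x)"
    using assms(2) hom_inj[OF assms(1)] by (auto simp: compose_def)
  moreover have "compose Q \<phi> ?\<psi> = (\<lambda>x\<in>Q. x)"
    using assms(2) by (auto simp: compose_def f_inv_into_f)
  ultimately show ?thesis using assms(1) unfolding isos_def by blast
qed

lemma Aut_group_simps [simp]:
  "carrier (Aut_group F P) = F P P"
  "\<one>\<^bsub>Aut_group F P\<^esub> = (\<lambda>x\<in>P. x)"
  by (simp_all add: Aut_group_def BijGroup_def)

lemma Aut_group_mult:
  "\<alpha> \<in> F P P \<Longrightarrow> \<beta> \<in> F P P \<Longrightarrow> \<alpha> \<otimes>\<^bsub>Aut_group F P\<^esub> \<beta> = compose P \<alpha> \<beta>"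
  using endo_Bij by (auto simp: Aut_group_def BijGroup_def)

lemma Aut_group_inv:
  assumes "\<alpha> \<in> F P P" "x \<in> P"
  shows "inv\<^bsub>Aut_group F P\<^esub> \<alpha> \<in> F P P" "(inv\<^bsub>Aut_group F P\<^esub> \<alpha>) x \<in> P"
    "\<alpha> ((inv\<^bsub>Aut_group F P\<^esub> \<alpha>) x) = x" "(inv\<^bsub>Aut_group F P\<^esub> \<alpha>) (\<alpha> x) = x"
proof -
  let ?\<beta> = "inv\<^bsub>Aut_group F P\<^esub> \<alpha>"
  have "subgroup P S" using objects assms(1) by blast
  then interpret A: group "Aut_group F P" by (rule group_Aut_group)
  have \<beta>: "?\<beta> \<in> F P P" using A.inv_closed[of \<alpha>] assms(1) by simp
  then show "?\<beta> \<in> F P P" "?\<beta> x \<in> P" using hom_into assms(2) by auto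
  have "compose P \<alpha> ?\<beta> = (\<lambda>x\<in>P. x)" "compose P ?\<beta> \<alpha> = (\<lambda>x\<in>P. x)"
    using A.r_inv[of \<alpha>] A.l_inv[of \<alpha>] assms(1) \<beta> by (simp_all add: Aut_group_mult)
  then show "\<alpha> (?\<beta> x) = x" "?\<beta> (\<alpha> x) = x"
    using assms(2) by (metis compose_eq restrict_apply')+
qed

lemma finite_Aut: "finite (F P P)"
proof (cases "subgroup P S")
  case True
  have "F P P \<subseteq> (P \<rightarrow>\<^sub>E P)"
    using hom_into hom_ext by (auto simp: PiE_def extensional_def)
  then show ?thesis using finite_PiE[of P "\<lambda>_. P"] subgroup_finite[OF True] finite_subset by blast
next
  case False
  then have "F P P = {}" using objects by blast
  then show ?thesis by simp
qed

section \<open>Invariant subgroups and coprime automorphisms\<close>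

definition invariant_subgroup :: "'a set \<Rightarrow> 'a set \<Rightarrow> bool" where
  "invariant_subgroup P X \<longleftrightarrow> subgroup X S \<and> X \<subseteq> P \<and> (\<forall>\<alpha>\<in>F P P. \<forall>x\<in>X. \<alpha> x \<in> X)"

text \<open>
  Inverses are powers, as \<open>S\<close> is finite.
\<close>

lemma invariant_subgroupI:
  assumes X: "invariant_subgroup P X" and sub: "Y \<subseteq> X" and one: "\<one> \<in> Y"
    and mult: "\<And>x y. x \<in> Y \<Longrightarrow> y \<in> Y \<Longrightarrow> x \<otimes> y \<in> Y"
    and auto: "\<And>\<alpha> x. \<alpha> \<in> F P P \<Longrightarrow> x \<in> Y \<Longrightarrow> \<alpha> x \<in> Y"
  shows "invariant_subgroup P Y"
proof -
  have X': "subgroup X S" "X \<subseteq> P" using X by (auto simp: invariant_subgroup_def)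
  have YS: "Y \<subseteq> carrier S" using sub subgroup.subset[OF X'(1)] by blast
  have pow: "x [^] n \<in> Y" if "x \<in> Y" for x and n :: nat
    using that one mult by (induction n) auto
  have "inv x \<in> Y" if x: "x \<in> Y" for x
  proof -
    have xS: "x \<in> carrier S" using x YS by blast
    have "order S \<noteq> 0" using finite_carrier order_gt_0_iff_finite by simp
    then obtain m where m: "order S = Suc m" by (cases "order S") auto
    have "x [^] m \<otimes> x = \<one>" using pow_order_eq_1[OF xS] m by simp
    then have "inv x = x [^] m" using xS by (simp add: inv_equality)
    then show ?thesis using pow[OF x] by simp
  qed
  then have "subgroup Y S" using YS one mult by (intro subgroup.intro) auto
  then show ?thesis using sub X' auto by (auto simp: invariant_subgroup_def)
qed

lemma invariant_center_mod:
  assumes X: "invariant_subgroup P X" and N: "invariant_subgroup P N"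
    and nor: "N \<lhd> S\<lparr>carrier := X\<rparr>"
  shows "invariant_subgroup P (center_mod (S\<lparr>carrier := X\<rparr>) N)"
proof -
  let ?X = "S\<lparr>carrier := X\<rparr>"
  have XS: "subgroup X S" "X \<subseteq> P" using X by (auto simp: invariant_subgroup_def)
  interpret XG: group ?X using subgroup.subgroup_is_group[OF XS(1) is_group] .
  have M: "center_mod ?X N \<lhd> ?X" using XG.center_mod_normal(2)[OF nor] .
  have char: "x \<in> center_mod ?X N \<longleftrightarrow>
      x \<in> X \<and> (\<forall>y \<in> X. inv x \<otimes> (y \<otimes> x \<otimes> inv y) \<in> N)" for x
    using XS(1) by (auto simp: center_mod_def)
  show ?thesis
  proof (rule invariant_subgroupI[OF X])
    show "center_mod ?X N \<subseteq> X" by (auto simp: center_mod_def)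
    show "\<one> \<in> center_mod ?X N"
      using subgroup.one_closed[OF XG.normal_invE(1)[OF M]] by simp
    show "x \<otimes> y \<in> center_mod ?X N" if "x \<in> center_mod ?X N" "y \<in> center_mod ?X N" for x y
      using subgroup.m_closed[OF XG.normal_invE(1)[OF M] that] by simp
    fix \<alpha> x assume \<alpha>: "\<alpha> \<in> F P P" and x: "x \<in> center_mod ?X N"
    have xX: "x \<in> X" using x char by blast
    then have \<alpha>x: "\<alpha> x \<in> X" using X \<alpha> by (auto simp: invariant_subgroup_def)
    have "inv (\<alpha> x) \<otimes> (y \<otimes> \<alpha> x \<otimes> inv y) \<in> N" if y: "y \<in> X" for y
    proof -
      let ?z = "(inv\<^bsub>Aut_group F P\<^esub> \<alpha>) y"
      have yP: "y \<in> P" using y XS by blast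
      have z: "?z \<in> X" "\<alpha> ?z = y"
        using Aut_group_inv[OF \<alpha> yP] X y by (auto simp: invariant_subgroup_def)
      have "inv x \<otimes> (?z \<otimes> x \<otimes> inv ?z) \<in> N" using x char z(1) by blast
      then have "\<alpha> (inv x \<otimes> (?z \<otimes> x \<otimes> inv ?z)) \<in> N"
        using N \<alpha> by (auto simp: invariant_subgroup_def)
      moreover have "\<alpha> (inv x \<otimes> (?z \<otimes> x \<otimes> inv ?z)) = inv (\<alpha> x) \<otimes> (y \<otimes> \<alpha> x \<otimes> inv y)"
      proof -
        have P: "subgroup P S" using objects \<alpha> by blast
        have mem: "x \<in> P" "?z \<in> P" using xX z XS by auto
        then show ?thesis
          using subgroup.m_closed[OF P] subgroup.m_inv_closed[OF P] z(2)
          by (simp add: hom_mult[OF \<alpha>] hom_inverse[OF \<alpha>])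
      qed
      ultimately show ?thesis by (simp only:)
    qed
    then show "\<alpha> x \<in> center_mod ?X N" using \<alpha>x char by blast
  qed
qed

text \<open>
  These are the automorphisms that fix every coset \<open>x K\<close> with \<open>x \<in> X\<close>.
\<close>

lemma normal_differences_in:
  assumes X: "invariant_subgroup P X" and K: "invariant_subgroup P K"
    and P: "subgroup P S"
  shows "{\<alpha> \<in> F P P. \<forall>x\<in>X. inv x \<otimes> \<alpha> x \<in> K} \<lhd> Aut_group F P" (is "?N \<lhd> _")
proof -
  interpret A: group "Aut_group F P" using P by (rule group_Aut_group)
  have XS: "subgroup X S" "X \<subseteq> P" using X by (auto simp: invariant_subgroup_def)
  have KS: "subgroup K S" using K by (simp add: invariant_subgroup_def)
  note memX = subgroup.mem_carrier[OF XS(1)]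
  have im: "\<alpha> x \<in> X" if "\<alpha> \<in> F P P" "x \<in> X" for \<alpha> x
    using that X by (simp add: invariant_subgroup_def)
  have N: "subgroup ?N (Aut_group F P)"
  proof
    show "?N \<subseteq> carrier (Aut_group F P)" by auto
    show "\<one>\<^bsub>Aut_group F P\<^esub> \<in> ?N"
      using identity[OF P P] memX XS subgroup.one_closed[OF KS] by auto
  next
    fix \<alpha> \<beta> assume a: "\<alpha> \<in> ?N" and b: "\<beta> \<in> ?N"
    have "inv x \<otimes> \<alpha> (\<beta> x) \<in> K" if x: "x \<in> X" for x
    proof -
      have bx: "\<beta> x \<in> X" "\<alpha> (\<beta> x) \<in> X" using im a b x by auto
      have "(inv x \<otimes> \<beta> x) \<otimes> (inv (\<beta> x) \<otimes> \<alpha> (\<beta> x)) \<in> K"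
        using a b x bx subgroup.m_closed[OF KS] by blast
      moreover have "(inv x \<otimes> \<beta> x) \<otimes> (inv (\<beta> x) \<otimes> \<alpha> (\<beta> x)) = inv x \<otimes> \<alpha> (\<beta> x)"
        using memX[OF x] memX[OF bx(1)] memX[OF bx(2)]
          m_assoc[of "\<beta> x" "inv (\<beta> x)" "\<alpha> (\<beta> x)", symmetric] by (simp add: m_assoc)
      ultimately show ?thesis by (simp only:)
    qed
    then show "\<alpha> \<otimes>\<^bsub>Aut_group F P\<^esub> \<beta> \<in> ?N"
      using a b composition XS(2) by (auto simp: Aut_group_mult compose_eq)
  next
    fix \<alpha> assume a: "\<alpha> \<in> ?N"
    then have \<alpha>: "\<alpha> \<in> F P P" by blast
    let ?\<beta> = "inv\<^bsub>Aut_group F P\<^esub> \<alpha>"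
    have \<beta>: "?\<beta> \<in> F P P" using A.inv_closed[of \<alpha>] \<alpha> by simp
    have "inv x \<otimes> ?\<beta> x \<in> K" if x: "x \<in> X" for x
    proof -
      have y: "?\<beta> x \<in> X" "\<alpha> (?\<beta> x) = x" using im[OF \<beta> x] Aut_group_inv[OF \<alpha>, of x] x XS(2) by auto
      then have "inv (?\<beta> x) \<otimes> x \<in> K" using a by force
      then have "inv (inv (?\<beta> x) \<otimes> x) \<in> K" using subgroup.m_inv_closed[OF KS] by blast
      then show ?thesis using memX[OF x] memX[OF y(1)] by (simp add: inv_mult_group)
    qed
    then show "?\<beta> \<in> ?N" using \<beta> by blast
  qed
  show ?thesis
    unfolding A.normal_inv_iff
  proof (intro conjI ballI N)
    fix \<alpha> \<beta> assume "\<alpha> \<in> carrier (Aut_group F P)" and b: "\<beta> \<in> ?N"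
    then have \<alpha>: "\<alpha> \<in> F P P" and \<beta>: "\<beta> \<in> F P P" by auto
    let ?\<gamma> = "inv\<^bsub>Aut_group F P\<^esub> \<alpha>"
    have \<gamma>: "?\<gamma> \<in> F P P" using A.inv_closed[of \<alpha>] \<alpha> by simp
    have ab: "compose P \<alpha> \<beta> \<in> F P P" using composition \<alpha> \<beta> by blast
    have "inv x \<otimes> \<alpha> (\<beta> (?\<gamma> x)) \<in> K" if x: "x \<in> X" for x
    proof -
      let ?y = "?\<gamma> x"
      have y: "?y \<in> X" "\<alpha> ?y = x" using im[OF \<gamma> x] Aut_group_inv[OF \<alpha>, of x] x XS(2) by auto
      have "\<alpha> (inv ?y \<otimes> \<beta> ?y) \<in> K" using b y(1) K \<alpha> by (auto simp: invariant_subgroup_def)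
      moreover have "\<alpha> (inv ?y \<otimes> \<beta> ?y) = inv x \<otimes> \<alpha> (\<beta> ?y)"
      proof -
        have "?y \<in> P" "\<beta> ?y \<in> P" "inv ?y \<in> P"
          using y im[OF \<beta> y(1)] XS(2) subgroup.m_inv_closed[OF P] by auto
        then show ?thesis using y(2) by (simp add: hom_mult[OF \<alpha>] hom_inverse[OF \<alpha>])
      qed
      ultimately show ?thesis by (simp only:)
    qed
    moreover have "?\<gamma> x \<in> P" if "x \<in> X" for x using hom_into[OF \<gamma>] that XS(2) by blast
    ultimately show "\<alpha> \<otimes>\<^bsub>Aut_group F P\<^esub> \<beta> \<otimes>\<^bsub>Aut_group F P\<^esub> ?\<gamma> \<in> ?N"
      using composition[OF \<gamma> ab] XS(2) by (auto simp: Aut_group_mult[OF \<alpha> \<beta>] Aut_group_mult[OF ab \<gamma>] compose_eq)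
  qed
qed

text \<open>
  Closure under conjugation by \<open>Aut\<^sub>F(P)\<close> is expressed pointwise, as \<open>l \<alpha> = \<alpha> m\<close>.
\<close>

definition coprime_family :: "'a set \<Rightarrow> ('a \<Rightarrow> 'a) set \<Rightarrow> bool" where
  "coprime_family P L \<longleftrightarrow> L \<subseteq> F P P \<and>
     (\<forall>l\<in>L. \<exists>n. coprime n p \<and> l [^]\<^bsub>Aut_group F P\<^esub> n = \<one>\<^bsub>Aut_group F P\<^esub>) \<and>
     (\<forall>\<alpha>\<in>F P P. \<forall>l\<in>L. \<exists>m\<in>L. \<forall>x\<in>P. l (\<alpha> x) = \<alpha> (m x))"

lemma coprime_family_of_normal:
  assumes P: "subgroup P S" and B: "B \<lhd> Aut_group F P"
  shows "coprime_family P
    {l \<in> B. \<exists>n. coprime n p \<and> l [^]\<^bsub>Aut_group F P\<^esub> n = \<one>\<^bsub>Aut_group F P\<^esub>}" (is "coprime_family P ?L")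
proof -
  interpret A: group "Aut_group F P" using P by (rule group_Aut_group)
  have BF: "B \<subseteq> F P P" using subgroup.subset[OF A.normal_invE(1)[OF B]] by simp
  have "\<exists>m\<in>?L. \<forall>x\<in>P. l (\<alpha> x) = \<alpha> (m x)" if \<alpha>: "\<alpha> \<in> F P P" and l: "l \<in> ?L" for \<alpha> l
  proof -
    let ?\<gamma> = "inv\<^bsub>Aut_group F P\<^esub> \<alpha>"
    let ?m = "?\<gamma> \<otimes>\<^bsub>Aut_group F P\<^esub> l \<otimes>\<^bsub>Aut_group F P\<^esub> inv\<^bsub>Aut_group F P\<^esub> ?\<gamma>"
    have lF: "l \<in> F P P" using l BF by blast
    have \<alpha>A: "\<alpha> \<in> carrier (Aut_group F P)" and lA: "l \<in> carrier (Aut_group F P)"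
      using \<alpha> lF by simp_all
    have \<gamma>: "?\<gamma> \<in> carrier (Aut_group F P)" using A.inv_closed[OF \<alpha>A] .
    obtain n where n: "coprime n p" "l [^]\<^bsub>Aut_group F P\<^esub> n = \<one>\<^bsub>Aut_group F P\<^esub>" using l by blast
    have "?m \<in> B" using A.normal_invE(2)[OF B \<gamma>] l by blast
    moreover have "?m [^]\<^bsub>Aut_group F P\<^esub> n = \<one>\<^bsub>Aut_group F P\<^esub>"
      unfolding A.conj_pow[OF \<gamma> lA] n(2) using A.r_one[OF \<gamma>] A.r_inv[OF \<gamma>] by metis
    ultimately have "?m \<in> ?L" using n(1) by blast
    moreover have "l (\<alpha> x) = \<alpha> (?m x)" if x: "x \<in> P" for x
    proof -
      have gF: "?\<gamma> \<in> F P P" using \<gamma> by simp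
      have c: "compose P ?\<gamma> l \<in> F P P" using composition[OF lF gF] .
      have "?m x = ?\<gamma> (l (\<alpha> x))"
        using x hom_into[OF \<alpha> x] A.inv_inv[OF \<alpha>A]
        by (simp add: Aut_group_mult[OF gF lF] Aut_group_mult[OF c \<alpha>] compose_eq)
      then show ?thesis using Aut_group_inv(3)[OF \<alpha>] hom_into[OF lF hom_into[OF \<alpha> x]] by simp
    qed
    ultimately show ?thesis by blast
  qed
  moreover have "?L \<subseteq> F P P" using BF by blast
  ultimately show ?thesis unfolding coprime_family_def by blast
qed

text \<open>
  If \<open>l x = x c\<close> with \<open>c\<close> fixed by \<open>l\<close>, then iterating \<open>l\<close> multiplies \<open>x\<close> by the powers of \<open>c\<close>. So the
  order of \<open>l\<close> annihilates \<open>c\<close>, which has \<open>p\<close>-power order.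
\<close>

lemma coprime_order_fixes:
  assumes l: "l \<in> F P P" and n: "l [^]\<^bsub>Aut_group F P\<^esub> n = \<one>\<^bsub>Aut_group F P\<^esub>" "coprime n p"
    and x: "x \<in> P" and fix_c: "l (inv x \<otimes> l x) = inv x \<otimes> l x"
  shows "l x = x"
proof -
  have P: "subgroup P S" using objects l by blast
  interpret A: group "Aut_group F P" using P by (rule group_Aut_group)
  define c where "c = inv x \<otimes> l x"
  have xS: "x \<in> carrier S" "l x \<in> carrier S" using hom_carrier[OF l x] by auto
  have c: "c \<in> P"
    using x l hom_into P subgroup.m_closed subgroup.m_inv_closed unfolding c_def by metis
  then have cS: "c \<in> carrier S" using hom_carrier[OF l] by blast
  have lx: "l x = x \<otimes> c" using xS by (simp add: c_def m_assoc[symmetric])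
  have lc: "l c = c" using fix_c by (simp add: c_def)
  have iter: "(l [^]\<^bsub>Aut_group F P\<^esub> k) x = x \<otimes> c [^] k" for k :: nat
  proof (induction k)
    case 0
    then show ?case using x xS by simp
  next
    case (Suc k)
    let ?m = "l [^]\<^bsub>Aut_group F P\<^esub> k"
    have m: "?m \<in> F P P" using A.nat_pow_closed[of l k] l by simp
    have lk: "?m c = c"
    proof (induction k)
      case (Suc k)
      have "l [^]\<^bsub>Aut_group F P\<^esub> k \<in> F P P" using A.nat_pow_closed[of l k] l by simp
      then show ?case using Suc l lc c by (simp add: Aut_group_mult compose_eq)
    qed (use c in simp)
    have "(l [^]\<^bsub>Aut_group F P\<^esub> Suc k) x = ?m (x \<otimes> c)"
      using l m x by (simp add: Aut_group_mult compose_eq lx)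
    also have "\<dots> = x \<otimes> c [^] Suc k"
      using hom_mult[OF m x c] Suc lk xS cS by (simp add: m_assoc)
    finally show ?case .
  qed
  have "x \<otimes> c [^] n = x" using iter[of n] n(1) x by simp
  then have "c [^] n \<in> {\<one>}" using xS cS by simp
  moreover have "c [^] order S \<in> {\<one>}" using cS pow_order_eq_1 by simp
  moreover have "coprime n (order S)"
    using p_power_order n(2) by (metis coprime_power_right_iff)
  ultimately have "c \<in> {\<one>}"
    using coprime_powers_mem[of "{\<one>}" c n "order S"] cS triv_subgroup by blast
  then show ?thesis using lx xS by simp
qed

definition fixed_points :: "('a \<Rightarrow> 'a) set \<Rightarrow> 'a set \<Rightarrow> 'a set" where
  "fixed_points L X = {x \<in> X. \<forall>l \<in> L. l x = x}"

lemma invariant_fixed_points: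
  assumes X: "invariant_subgroup P X" and L: "coprime_family P L"
  shows "invariant_subgroup P (fixed_points L X)"
proof (rule invariant_subgroupI[OF X])
  have XS: "subgroup X S" "X \<subseteq> P" using X by (auto simp: invariant_subgroup_def)
  have LF: "L \<subseteq> F P P" using L by (simp add: coprime_family_def)
  show "fixed_points L X \<subseteq> X" by (auto simp: fixed_points_def)
  show "\<one> \<in> fixed_points L X"
    using subgroup.one_closed[OF XS(1)] hom_unit LF by (auto simp: fixed_points_def)
  show "x \<otimes> y \<in> fixed_points L X" if "x \<in> fixed_points L X" "y \<in> fixed_points L X" for x y
  proof -
    have xy: "x \<in> X" "y \<in> X" "x \<in> P" "y \<in> P" using that XS by (auto simp: fixed_points_def)
    have "l (x \<otimes> y) = x \<otimes> y" if l: "l \<in> L" for l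
    proof -
      have "l x = x" "l y = y" using that l \<open>x \<in> fixed_points L X\<close> \<open>y \<in> fixed_points L X\<close>
        unfolding fixed_points_def by blast+
      then show ?thesis using hom_mult[OF subsetD[OF LF l] xy(3,4)] by simp
    qed
    then show ?thesis using subgroup.m_closed[OF XS(1)] xy by (auto simp: fixed_points_def)
  qed
  show "\<alpha> x \<in> fixed_points L X" if \<alpha>: "\<alpha> \<in> F P P" and x: "x \<in> fixed_points L X" for \<alpha> x
  proof -
    have xX: "x \<in> X" "x \<in> P" using x XS by (auto simp: fixed_points_def)
    have "l (\<alpha> x) = \<alpha> x" if l: "l \<in> L" for l
    proof -
      obtain m where "m \<in> L" "\<forall>x\<in>P. l (\<alpha> x) = \<alpha> (m x)"
        using L \<alpha> l unfolding coprime_family_def by blast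
      moreover from this have "m x = x" using x by (auto simp: fixed_points_def)
      ultimately show ?thesis using xX by simp
    qed
    then show ?thesis using X \<alpha> xX by (auto simp: fixed_points_def invariant_subgroup_def)
  qed
qed

text \<open>
  The form in which coprime action is used: if \<open>[X, L]\<close> is fixed by \<open>L\<close>, then so is \<open>X\<close>.
\<close>

lemma fixes_all_if_differences_fixed:
  assumes X: "invariant_subgroup P X" and L: "coprime_family P L"
    and diff: "\<And>x l. x \<in> X \<Longrightarrow> l \<in> L \<Longrightarrow> inv x \<otimes> l x \<in> fixed_points L X"
  shows "fixed_points L X = X"
proof -
  have XP: "X \<subseteq> P" using X by (auto simp: invariant_subgroup_def)
  have "l x = x" if x: "x \<in> X" and l: "l \<in> L" for x l
  proof -
    obtain n where n: "l [^]\<^bsub>Aut_group F P\<^esub> n = \<one>\<^bsub>Aut_group F P\<^esub>" "coprime n p"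
      using L l by (auto simp: coprime_family_def)
    have "l (inv x \<otimes> l x) = inv x \<otimes> l x" using diff[OF x l] l by (simp add: fixed_points_def)
    moreover have "l \<in> F P P" using L l by (auto simp: coprime_family_def)
    ultimately show ?thesis using coprime_order_fixes[OF _ n] x XP by blast
  qed
  then show ?thesis by (auto simp: fixed_points_def)
qed

section \<open>Minimal invariant subgroups with a nontrivial coprime action\<close>

definition minimal_moved :: "'a set \<Rightarrow> ('a \<Rightarrow> 'a) set \<Rightarrow> 'a set \<Rightarrow> bool" where
  "minimal_moved P L X \<longleftrightarrow> invariant_subgroup P X \<and> fixed_points L X \<noteq> X \<and>
     (\<forall>Y. invariant_subgroup P Y \<longrightarrow> Y \<subset> X \<longrightarrow> fixed_points L Y = Y)"

lemma minimal_moved_dichotomy: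
  assumes "minimal_moved P L X" "invariant_subgroup P Y" "Y \<subseteq> X"
  shows "Y = X \<or> Y \<subseteq> fixed_points L X"
  using assms by (fastforce simp: minimal_moved_def fixed_points_def)

text \<open>
  Let \<open>N\<close> be maximal among the invariant subgroups that are normal in \<open>X\<close> and consist of fixed
  points. The preimage of the centre of \<open>X / N\<close> is invariant and strictly larger, so it is not fixed
  pointwise, and by minimality it is \<open>X\<close>. Hence \<open>X / N\<close> is abelian.
\<close>

lemma minimal_moved_commutator:
  assumes min: "minimal_moved P L X" and L: "coprime_family P L" and x: "x \<in> X" and y: "y \<in> X"
  shows "inv x \<otimes> (y \<otimes> x \<otimes> inv y) \<in> fixed_points L X"
proof -
  let ?K = "fixed_points L X" and ?X = "S\<lparr>carrier := X\<rparr>"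
  have X: "invariant_subgroup P X" using min by (simp add: minimal_moved_def)
  have XS: "subgroup X S" "X \<subseteq> P" using X by (auto simp: invariant_subgroup_def)
  interpret XG: finite_p_group ?X p using finite_p_group_subgroup[OF XS(1)] .
  have KX: "?K \<subseteq> X" "?K \<noteq> X" using min by (auto simp: minimal_moved_def fixed_points_def)
  have K: "invariant_subgroup P ?K" using invariant_fixed_points[OF X L] .
  have finK: "finite ?K" using subgroup_finite K by (simp add: invariant_subgroup_def)
  let ?Q = "\<lambda>N. invariant_subgroup P N \<and> N \<lhd> ?X \<and> N \<subseteq> ?K"
  have "\<one> \<in> ?K" using K by (simp add: invariant_subgroup_def subgroup.one_closed)
  then have one: "?Q {\<one>}"
    using XG.one_is_normal invariant_subgroupI[OF X, of "{\<one>}"] KX hom_unit by auto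
  have bound: "\<forall>N. ?Q N \<longrightarrow> card N < Suc (card ?K)"
    using card_mono[OF finK] less_Suc_eq_le by blast
  have "\<exists>N. ?Q N \<and> (\<forall>M. ?Q M \<longrightarrow> card M \<le> card N)"
    by (rule ex_has_greatest_nat[of ?Q "{\<one>}" card "Suc (card ?K)"]) (rule one, rule bound)
  then obtain N where N: "invariant_subgroup P N" "N \<lhd> ?X" "N \<subseteq> ?K"
    and max: "\<And>M. ?Q M \<Longrightarrow> card M \<le> card N" by blast
  let ?M = "center_mod ?X N"
  have M: "invariant_subgroup P ?M" "?M \<lhd> ?X" "N \<subseteq> ?M"
    using invariant_center_mod[OF X N(1,2)] XG.center_mod_normal[OF N(2)] by auto
  have "N \<noteq> X" using N(3) KX by blast
  then have "N \<subset> ?M" using XG.center_mod_grows[OF N(2)] M(3) by auto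
  have "\<not> ?M \<subseteq> ?K"
  proof
    assume "?M \<subseteq> ?K"
    then have "card ?M \<le> card N" "finite ?M" using max M finK finite_subset by blast+
    then show False using psubset_card_mono[of ?M N] \<open>N \<subset> ?M\<close> by linarith
  qed
  moreover have "?M \<subseteq> X" by (auto simp: center_mod_def)
  ultimately have "?M = X" using minimal_moved_dichotomy[OF min M(1)] by blast
  then have "x \<in> ?M" using x by simp
  then have "inv x \<otimes> (y \<otimes> x \<otimes> inv y) \<in> N" using x y XS(1) by (simp add: center_mod_def)
  then show ?thesis using N(3) by blast
qed

text \<open>
  As \<open>L\<close> fixes \<open>k\<close> and its conjugates under \<open>X\<close>, conjugation by \<open>x\<close> and by \<open>l x\<close> agree on the fixed
  points. So the centralizer of the fixed points in \<open>X\<close>, an invariant subgroup, contains \<open>[X, L]\<close>.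
  If it were proper, \<open>[X, L]\<close> would be fixed and the action trivial.
\<close>

lemma minimal_moved_central:
  assumes min: "minimal_moved P L X" and L: "coprime_family P L"
    and x: "x \<in> X" and k: "k \<in> fixed_points L X"
  shows "x \<otimes> k = k \<otimes> x"
proof -
  let ?K = "fixed_points L X"
  have X: "invariant_subgroup P X" using min by (simp add: minimal_moved_def)
  have XS: "subgroup X S" "X \<subseteq> P" using X by (auto simp: invariant_subgroup_def)
  note memX = subgroup.mem_carrier[OF XS(1)]
  have K: "invariant_subgroup P ?K" using invariant_fixed_points[OF X L] .
  have KS: "subgroup ?K S" using K by (simp add: invariant_subgroup_def)
  have KX: "?K \<subseteq> X" by (auto simp: fixed_points_def)
  let ?C = "{x \<in> X. \<forall>k \<in> ?K. x \<otimes> k = k \<otimes> x}"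
  have C: "invariant_subgroup P ?C"
  proof (rule invariant_subgroupI[OF X])
    show "\<one> \<in> ?C" using subgroup.one_closed[OF XS(1)] KX memX by auto
    show "x \<otimes> y \<in> ?C" if "x \<in> ?C" "y \<in> ?C" for x y
    proof -
      have xy: "x \<in> X" "y \<in> X" using that by auto
      have "x \<otimes> y \<otimes> k = k \<otimes> (x \<otimes> y)" if k: "k \<in> ?K" for k
      proof -
        have kS: "k \<in> carrier S" using k KX memX by blast
        have "x \<otimes> y \<otimes> k = x \<otimes> (k \<otimes> y)"
          using \<open>y \<in> ?C\<close> k kS xy memX by (simp add: m_assoc)
        also have "\<dots> = (k \<otimes> x) \<otimes> y"
          using \<open>x \<in> ?C\<close> k kS xy memX by (simp add: m_assoc[symmetric])
        finally show ?thesis using kS xy memX by (simp add: m_assoc)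
      qed
      then show ?thesis using xy subgroup.m_closed[OF XS(1)] by blast
    qed
    show "\<alpha> x \<in> ?C" if \<alpha>: "\<alpha> \<in> F P P" and x: "x \<in> ?C" for \<alpha> x
    proof -
      have xX: "x \<in> X" using x by blast
      have "\<alpha> x \<otimes> k = k \<otimes> \<alpha> x" if k: "k \<in> ?K" for k
      proof -
        let ?j = "(inv\<^bsub>Aut_group F P\<^esub> \<alpha>) k"
        have kP: "k \<in> P" using k KX XS by blast
        have j: "?j \<in> ?K" "\<alpha> ?j = k"
          using Aut_group_inv[OF \<alpha> kP] K k by (auto simp: invariant_subgroup_def)
        then have "\<alpha> (x \<otimes> ?j) = \<alpha> (?j \<otimes> x)" using x by simp
        moreover have "x \<in> P" "?j \<in> P" using xX j(1) KX XS by auto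
        ultimately show ?thesis using j(2) by (simp add: hom_mult[OF \<alpha>])
      qed
      then show ?thesis using X \<alpha> xX by (auto simp: invariant_subgroup_def)
    qed
  qed blast
  have "?C = X"
  proof (rule ccontr)
    assume "?C \<noteq> X"
    then have CK: "?C \<subseteq> ?K" using minimal_moved_dichotomy[OF min C] by blast
    have "inv x \<otimes> l x \<in> ?K" if x: "x \<in> X" and l: "l \<in> L" for x l
    proof -
      have lF: "l \<in> F P P" using L l by (auto simp: coprime_family_def)
      then have lx: "l x \<in> X" using X x by (auto simp: invariant_subgroup_def)
      have xP: "x \<in> P" and xS: "x \<in> carrier S" "l x \<in> carrier S" using x lx XS memX by auto
      have "inv x \<otimes> l x \<otimes> k = k \<otimes> (inv x \<otimes> l x)" if k: "k \<in> ?K" for k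
      proof -
        have kX: "k \<in> X" "k \<in> P" and kS: "k \<in> carrier S" using k KX XS memX by auto
        \<comment> \<open>the conjugate of a fixed point differs from it by a commutator, so it is fixed too\<close>
        have "inv k \<otimes> (x \<otimes> k \<otimes> inv x) \<in> ?K"
          by (rule minimal_moved_commutator[OF min L kX(1) x])
        then have "k \<otimes> (inv k \<otimes> (x \<otimes> k \<otimes> inv x)) \<in> ?K" by (rule subgroup.m_closed[OF KS k])
        moreover have "k \<otimes> (inv k \<otimes> (x \<otimes> k \<otimes> inv x)) = x \<otimes> k \<otimes> inv x"
          using kS xS by (simp add: m_assoc[symmetric])
        ultimately have "x \<otimes> k \<otimes> inv x \<in> ?K" by (simp only:)
        then have "x \<otimes> k \<otimes> inv x = l (x \<otimes> k \<otimes> inv x)" using l by (auto simp: fixed_points_def)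
        also have "\<dots> = l x \<otimes> k \<otimes> inv (l x)"
        proof -
          have P: "subgroup P S" using objects lF by blast
          have "l k = k" using k l by (simp add: fixed_points_def)
          then show ?thesis
            using subgroup.m_closed[OF P] subgroup.m_inv_closed[OF P] xP kX
            by (simp add: hom_mult[OF lF] hom_inverse[OF lF])
        qed
        finally have eq: "x \<otimes> k \<otimes> inv x = l x \<otimes> k \<otimes> inv (l x)" .
        have "inv x \<otimes> l x \<otimes> k = inv x \<otimes> (l x \<otimes> k \<otimes> inv (l x)) \<otimes> l x"
          using kS xS by (simp add: m_assoc)
        also have "\<dots> = inv x \<otimes> (x \<otimes> k \<otimes> inv x) \<otimes> l x" by (simp only: eq)
        also have "\<dots> = k \<otimes> (inv x \<otimes> l x)"
        proof -
          have "inv x \<otimes> (x \<otimes> (k \<otimes> (inv x \<otimes> l x))) = k \<otimes> (inv x \<otimes> l x)"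
            using kS xS m_assoc[of "inv x" x "k \<otimes> (inv x \<otimes> l x)", symmetric] by simp
          then show ?thesis using kS xS by (simp add: m_assoc)
        qed
        finally show ?thesis .
      qed
      moreover have "inv x \<otimes> l x \<in> X"
        using x lx XS(1) subgroup.m_closed subgroup.m_inv_closed by metis
      ultimately show ?thesis using CK by blast
    qed
    then have "?K = X" using fixes_all_if_differences_fixed[OF X L] by blast
    then show False using min by (simp add: minimal_moved_def)
  qed
  then show ?thesis using x k by blast
qed

text \<open>
  By the two preceding lemmas \<open>X\<close> has class at most two, with central commutators in the fixed
  points, so that the power formula applies.
\<close>

lemma minimal_moved_mult_pow:
  assumes min: "minimal_moved P L X" and L: "coprime_family P L" and x: "x \<in> X" and y: "y \<in> X"
  obtains c where "c \<in> fixed_points L X"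
    "\<And>n :: nat. y [^] n \<otimes> x = x \<otimes> y [^] n \<otimes> c [^] n"
    "\<And>n :: nat. (x \<otimes> y) [^] n = x [^] n \<otimes> y [^] n \<otimes> c [^] (n choose 2)"
proof -
  have "subgroup X S" using min by (auto simp: minimal_moved_def invariant_subgroup_def)
  then have X: "x \<in> carrier S" "y \<in> carrier S" "inv x \<in> X" "fixed_points L X \<subseteq> carrier S"
    using x y subgroup.mem_carrier subgroup.m_inv_closed by (fastforce simp: fixed_points_def)+
  let ?c = "inv y \<otimes> (inv x \<otimes> y \<otimes> inv (inv x))"
  have c: "?c \<in> fixed_points L X" by (rule minimal_moved_commutator[OF min L y X(3)])
  have "x \<otimes> (y \<otimes> (inv y \<otimes> (inv x \<otimes> (y \<otimes> x)))) = y \<otimes> x"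
    using X(1,2) m_assoc[of y "inv y" "inv x \<otimes> (y \<otimes> x)", symmetric]
      m_assoc[of x "inv x" "y \<otimes> x", symmetric] by simp
  then have "y \<otimes> x = x \<otimes> y \<otimes> ?c" using X(1,2) by (simp add: m_assoc)
  moreover have "?c \<otimes> x = x \<otimes> ?c" "?c \<otimes> y = y \<otimes> ?c"
    using minimal_moved_central[OF min L _ c] x y by metis+
  ultimately show thesis
    using that[OF c] mult_pow_central_commutator[OF X(1,2) subsetD[OF X(4) c]] by blast
qed

text \<open>
  The elements whose \<open>p\<close>-th power is fixed form an invariant subgroup, since \<open>X\<close> is abelian modulo
  the central subgroup of fixed points. It cannot consist of fixed points: otherwise, going down
  from \<open>x [^] order S = \<one>\<close> one \<open>p\<close>-th root at a time, every element of \<open>X\<close> would be fixed.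
\<close>

lemma minimal_moved_prime_power:
  assumes min: "minimal_moved P L X" and L: "coprime_family P L" and x: "x \<in> X"
  shows "x [^] p \<in> fixed_points L X"
proof -
  let ?K = "fixed_points L X"
  have X: "invariant_subgroup P X" using min by (simp add: minimal_moved_def)
  have XS: "subgroup X S" "X \<subseteq> P" using X by (auto simp: invariant_subgroup_def)
  note memX = subgroup.mem_carrier[OF XS(1)]
  have K: "invariant_subgroup P ?K" using invariant_fixed_points[OF X L] .
  have KS: "subgroup ?K S" using K by (simp add: invariant_subgroup_def)
  have powX: "z [^] n \<in> X" if "z \<in> X" for z and n :: nat
    using that XS(1) by (induction n) (auto simp: subgroup.one_closed subgroup.m_closed)
  have powK: "z [^] n \<in> ?K" if "z \<in> ?K" for z and n :: nat
    using that KS by (induction n) (auto simp: subgroup.one_closed subgroup.m_closed)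
  let ?D = "{x \<in> X. x [^] p \<in> ?K}"
  have D: "invariant_subgroup P ?D"
  proof (rule invariant_subgroupI[OF X])
    show "\<one> \<in> ?D" using subgroup.one_closed[OF XS(1)] subgroup.one_closed[OF KS] by simp
    show "a \<otimes> b \<in> ?D" if ab: "a \<in> ?D" "b \<in> ?D" for a b
    proof -
      have abX: "a \<in> X" "b \<in> X" "a [^] p \<in> ?K" "b [^] p \<in> ?K" using ab by auto
      obtain c where c: "c \<in> ?K" "(a \<otimes> b) [^] p = a [^] p \<otimes> b [^] p \<otimes> c [^] (p choose 2)"
        using minimal_moved_mult_pow[OF min L abX(1,2)] by metis
      have "a [^] p \<otimes> b [^] p \<otimes> c [^] (p choose 2) \<in> ?K"
        using abX(3,4) powK[OF c(1)] by (intro subgroup.m_closed[OF KS])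
      then show ?thesis
        unfolding c(2)[symmetric] using subgroup.m_closed[OF XS(1) abX(1,2)] by blast
    qed
    show "\<alpha> a \<in> ?D" if \<alpha>: "\<alpha> \<in> F P P" and a: "a \<in> ?D" for \<alpha> a
    proof -
      have aX: "a \<in> X" "a \<in> P" using a XS by auto
      have "\<alpha> (a [^] p) \<in> ?K" using K \<alpha> a by (auto simp: invariant_subgroup_def)
      then show ?thesis
        using hom_power[OF \<alpha> aX(2)] X \<alpha> aX by (auto simp: invariant_subgroup_def)
    qed
  qed blast
  have "\<not> ?D \<subseteq> ?K"
  proof
    assume DK: "?D \<subseteq> ?K"
    have step: "z \<in> ?K" if "z \<in> X" "z [^] (p ^ n) \<in> ?K" for z n
      using that
    proof (induction n arbitrary: z)
      case 0
      then show ?case using memX by simp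
    next
      case (Suc n)
      have "(z [^] p) [^] (p ^ n) \<in> ?K" using Suc.prems memX by (simp add: nat_pow_pow)
      then have "z [^] p \<in> ?K" using Suc.IH powX[OF Suc.prems(1)] by blast
      then show ?case using Suc.prems(1) DK by blast
    qed
    obtain n where n: "order S = p ^ n" using p_power_order by blast
    have "X \<subseteq> ?K"
    proof
      fix z assume z: "z \<in> X"
      have "z [^] (p ^ n) \<in> ?K"
        using pow_order_eq_1[OF memX[OF z]] n subgroup.one_closed[OF KS] by simp
      then show "z \<in> ?K" using step z by blast
    qed
    then show False using min by (auto simp: minimal_moved_def fixed_points_def)
  qed
  then have "?D = X" using minimal_moved_dichotomy[OF min D] by blast
  then show ?thesis using x by blast
qed

text \<open>
  With \<open>r = p\<close>, or \<open>r = 4\<close> if \<open>p = 2\<close>, the \<open>r\<close>-th power map is multiplicative on \<open>X\<close>: commutators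
  have order dividing \<open>p\<close> because \<open>p\<close>-th powers are central, and \<open>p\<close> divides \<open>r choose 2\<close>. The latter
  fails for \<open>r = p = 2\<close>; this is where elements of order \<open>4\<close> enter. The kernel of the map contains
  \<open>[X, L]\<close>, as \<open>r\<close>-th powers are fixed, so by minimality it is all of \<open>X\<close>.
\<close>

lemma minimal_moved_exponent:
  assumes min: "minimal_moved P L X" and L: "coprime_family P L" and x: "x \<in> X"
  shows "x [^] (if p = 2 then 4 else p) = \<one>"
proof -
  define r where "r = (if p = 2 then 4 else p)"
  have pr: "p dvd r" by (auto simp: r_def)
  have pr2: "p dvd (r choose 2)"
  proof (cases "p = 2")
    case True
    then show ?thesis by (simp add: r_def choose_two)
  next
    case False
    then have "2 < p" using prime prime_ge_2_nat[of p] by simp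
    then show ?thesis using prime False by (simp add: r_def dvd_choose_prime)
  qed
  let ?K = "fixed_points L X"
  have X: "invariant_subgroup P X" using min by (simp add: minimal_moved_def)
  have XS: "subgroup X S" "X \<subseteq> P" using X by (auto simp: invariant_subgroup_def)
  note memX = subgroup.mem_carrier[OF XS(1)]
  have K: "invariant_subgroup P ?K" using invariant_fixed_points[OF X L] .
  have KS: "subgroup ?K S" using K by (simp add: invariant_subgroup_def)
  have powK: "z [^] n \<in> ?K" if "z \<in> ?K" for z and n :: nat
    using that KS by (induction n) (auto simp: subgroup.one_closed subgroup.m_closed)
  have mult: "(a \<otimes> b) [^] r = a [^] r \<otimes> b [^] r" if ab: "a \<in> X" "b \<in> X" for a b
  proof -
    \<comment> \<open>the swapping formula for the central element \<open>b [^] p\<close> shows that \<open>c [^] p = \<one>\<close>\<close>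
    obtain c where c: "c \<in> ?K" "b [^] p \<otimes> a = a \<otimes> b [^] p \<otimes> c [^] p"
      "(a \<otimes> b) [^] r = a [^] r \<otimes> b [^] r \<otimes> c [^] (r choose 2)"
      using minimal_moved_mult_pow[OF min L ab] by metis
    have cS: "c \<in> carrier S" using subgroup.mem_carrier[OF KS c(1)] .
    have "b [^] p \<otimes> a = a \<otimes> b [^] p"
      using minimal_moved_central[OF min L ab(1) minimal_moved_prime_power[OF min L ab(2)]] by simp
    then have "a \<otimes> b [^] p \<otimes> c [^] p = a \<otimes> b [^] p" using c(2) by simp
    then have cp: "c [^] p = \<one>" using memX ab cS by simp
    obtain j where "r choose 2 = p * j" using pr2 by blast
    then have "c [^] (r choose 2) = (c [^] p) [^] j" using cS by (simp add: nat_pow_pow)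
    then have "c [^] (r choose 2) = \<one>" using cp by simp
    then show ?thesis using c(3) memX ab by simp
  qed
  let ?E = "{x \<in> X. x [^] r = \<one>}"
  have E: "invariant_subgroup P ?E"
  proof (rule invariant_subgroupI[OF X])
    show "\<one> \<in> ?E" using subgroup.one_closed[OF XS(1)] by simp
    show "a \<otimes> b \<in> ?E" if "a \<in> ?E" "b \<in> ?E" for a b
      using that mult subgroup.m_closed[OF XS(1)] by simp
    show "\<alpha> a \<in> ?E" if \<alpha>: "\<alpha> \<in> F P P" and a: "a \<in> ?E" for \<alpha> a
    proof -
      have "a \<in> P" using a XS by blast
      then have "(\<alpha> a) [^] r = \<one>"
        using hom_power[OF \<alpha>, of a r] hom_unit[OF \<alpha>] a by simp
      then show ?thesis using X \<alpha> a by (auto simp: invariant_subgroup_def)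
    qed
  qed blast
  have diff: "inv z \<otimes> l z \<in> ?E" if z: "z \<in> X" and l: "l \<in> L" for z l
  proof -
    have lF: "l \<in> F P P" using L l by (auto simp: coprime_family_def)
    have lz: "l z \<in> X" "inv z \<in> X" "z \<in> P"
      using X lF z XS subgroup.m_inv_closed by (auto simp: invariant_subgroup_def)
    obtain j where "r = p * j" using pr by blast
    then have "z [^] r \<in> ?K"
      using powK[OF minimal_moved_prime_power[OF min L z], of j] memX[OF z] by (simp add: nat_pow_pow)
    then have "(l z) [^] r = z [^] r"
      using hom_power[OF lF lz(3), of r] l by (auto simp: fixed_points_def)
    then have "(inv z \<otimes> l z) [^] r = inv (z [^] r) \<otimes> z [^] r"
      using mult[OF lz(2,1)] memX[OF z] by (simp add: nat_pow_inv)
    then show ?thesis using memX[OF z] subgroup.m_closed[OF XS(1) lz(2,1)] by simp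
  qed
  have "\<not> ?E \<subseteq> ?K"
  proof
    assume "?E \<subseteq> ?K"
    then have "?K = X" using fixes_all_if_differences_fixed[OF X L] diff by blast
    then show False using min by (simp add: minimal_moved_def)
  qed
  then have "?E = X" using minimal_moved_dichotomy[OF min E] by blast
  then show ?thesis using x unfolding r_def by blast
qed

text \<open>
  A minimal invariant subgroup \<open>X\<close> of \<open>W\<close> moved by \<open>L\<close> has exponent \<open>r\<close>, so the assumptions \<open>ext\<close> and
  \<open>inner\<close> apply to all of its elements. Let \<open>E\<close> be a normal \<open>Aut\<^sub>F(S)\<close>-invariant subgroup of \<open>S\<close>
  maximal subject to not containing \<open>X\<close>. By \<open>ext\<close> the intersection \<open>X \<inter> E\<close> is invariant, hence
  consists of fixed points. By maximality \<open>X\<close> is central in \<open>S\<close> modulo \<open>E\<close>, so by \<open>inner\<close> the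
  elements of \<open>T\<close> move \<open>X\<close> only within \<open>X \<inter> E\<close>. This property passes to \<open>L\<close>, whose action on \<open>X\<close> is
  therefore trivial.
\<close>

lemma coprime_family_fixes_invariant:
  assumes L: "coprime_family P L" and P: "subgroup P S"
    and T: "T \<subseteq> F P P" "\<And>N. N \<lhd> Aut_group F P \<Longrightarrow> T \<subseteq> N \<Longrightarrow> L \<subseteq> N"
    and ext: "\<And>\<alpha> x. \<alpha> \<in> F P P \<Longrightarrow> x \<in> W \<Longrightarrow> x [^] (if p = 2 then 4 else p) = \<one> \<Longrightarrow>
      \<exists>\<beta> \<in> F (carrier S) (carrier S). \<alpha> x = \<beta> x"
    and inner: "\<And>t x. t \<in> T \<Longrightarrow> x \<in> W \<Longrightarrow> x [^] (if p = 2 then 4 else p) = \<one> \<Longrightarrow>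
      \<exists>g \<in> carrier S. t x = g \<otimes> x \<otimes> inv g"
  shows "invariant_subgroup P X \<Longrightarrow> X \<subseteq> W \<Longrightarrow> fixed_points L X = X"
proof (induction "card X" arbitrary: X rule: less_induct)
  case less
  note X = less.prems(1) and XW = less.prems(2)
  have XS: "subgroup X S" "X \<subseteq> P" using X by (auto simp: invariant_subgroup_def)
  have finX: "finite X" using subgroup_finite[OF XS(1)] .
  show ?case
  proof (rule ccontr)
    assume moved: "fixed_points L X \<noteq> X"
    have "fixed_points L Y = Y" if "invariant_subgroup P Y" "Y \<subset> X" for Y
      using less.hyps[OF psubset_card_mono[OF finX that(2)] that(1)] that(2) XW by blast
    then have min: "minimal_moved P L X" using X moved by (simp add: minimal_moved_def)
    let ?K = "fixed_points L X" and ?C = "carrier S"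
    have K: "invariant_subgroup P ?K" using invariant_fixed_points[OF X L] .
    note exponent = minimal_moved_exponent[OF min L]
    let ?Q = "\<lambda>E. invariant_subgroup ?C E \<and> E \<lhd> S \<and> \<not> X \<subseteq> E"
    have C: "invariant_subgroup ?C ?C"
      using subgroup_self hom_into by (auto simp: invariant_subgroup_def)
    have one: "?Q {\<one>}"
    proof (intro conjI)
      show "invariant_subgroup ?C {\<one>}"
        by (rule invariant_subgroupI[OF C]) (auto simp: hom_unit)
      show "{\<one>} \<lhd> S" by (rule one_is_normal)
      have "\<one> \<in> ?K" using K by (simp add: invariant_subgroup_def subgroup.one_closed)
      moreover have "?K \<subseteq> X" by (auto simp: fixed_points_def)
      ultimately show "\<not> X \<subseteq> {\<one>}" using moved by blast
    qed
    have bound: "\<forall>E. ?Q E \<longrightarrow> card E < Suc (card ?C)"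
      using card_mono[OF finite_carrier] less_Suc_eq_le
      by (auto simp: invariant_subgroup_def)
    have "\<exists>E. ?Q E \<and> (\<forall>M. ?Q M \<longrightarrow> card M \<le> card E)"
      by (rule ex_has_greatest_nat[of ?Q "{\<one>}" card "Suc (card ?C)"]) (rule one, rule bound)
    then obtain E where E: "invariant_subgroup ?C E" "E \<lhd> S" "\<not> X \<subseteq> E"
      and max: "\<And>M. ?Q M \<Longrightarrow> card M \<le> card E" by blast
    let ?M = "center_mod S E"
    have M: "invariant_subgroup ?C ?M" "?M \<lhd> S" "E \<subseteq> ?M"
      using invariant_center_mod[OF C E(1)] center_mod_normal[OF E(2)] E(2) by simp_all
    have "E \<noteq> ?C" using E(3) subgroup.subset[OF XS(1)] by blast
    then have "E \<subset> ?M" using center_mod_grows[OF E(2)] M(3) by blast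
    moreover have "finite ?M" using M(1) subgroup_finite by (simp add: invariant_subgroup_def)
    ultimately have "card E < card ?M" by (simp add: psubset_card_mono)
    then have XM: "X \<subseteq> ?M" using max[of ?M] M by fastforce
    have ES: "subgroup E S" using E(1) by (simp add: invariant_subgroup_def)
    have "invariant_subgroup P (X \<inter> E)"
    proof (rule invariant_subgroupI[OF X])
      show "\<one> \<in> X \<inter> E" using XS(1) ES by (simp add: subgroup.one_closed)
      show "x \<otimes> y \<in> X \<inter> E" if "x \<in> X \<inter> E" "y \<in> X \<inter> E" for x y
        using that XS(1) ES by (simp add: subgroup.m_closed)
      show "\<alpha> x \<in> X \<inter> E" if \<alpha>: "\<alpha> \<in> F P P" and x: "x \<in> X \<inter> E" for \<alpha> x
      proof -
        obtain \<beta> where \<beta>: "\<beta> \<in> F ?C ?C" "\<alpha> x = \<beta> x"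
          using ext[OF \<alpha>, of x] exponent[of x] x XW by blast
        then have "\<alpha> x \<in> E" using E(1) x by (auto simp: invariant_subgroup_def)
        then show ?thesis using X \<alpha> x by (auto simp: invariant_subgroup_def)
      qed
    qed blast
    then have EK: "X \<inter> E \<subseteq> ?K" using minimal_moved_dichotomy[OF min] E(3) by blast
    let ?N = "{\<alpha> \<in> F P P. \<forall>x\<in>X. inv x \<otimes> \<alpha> x \<in> ?K}"
    have "T \<subseteq> ?N"
    proof
      fix t assume t: "t \<in> T"
      have "inv x \<otimes> t x \<in> ?K" if x: "x \<in> X" for x
      proof -
        obtain g where g: "g \<in> ?C" "t x = g \<otimes> x \<otimes> inv g"
          using inner[OF t, of x] exponent[OF x] x XW by blast
        have "inv x \<otimes> t x \<in> E" using XM x g by (auto simp: center_mod_def)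
        moreover have "t x \<in> X" using X t T(1) x by (auto simp: invariant_subgroup_def)
        then have "inv x \<otimes> t x \<in> X"
          using x XS(1) by (simp add: subgroup.m_closed subgroup.m_inv_closed)
        ultimately show ?thesis using EK by blast
      qed
      then show "t \<in> ?N" using t T(1) by blast
    qed
    then have "L \<subseteq> ?N" using T(2) normal_differences_in[OF X K P] by blast
    then have "?K = X" using fixes_all_if_differences_fixed[OF X L] by blast
    then show False using moved by simp
  qed
qed

section \<open>The hyperfocal subgroup\<close>

lemma coprime_order_in_O_upper:
  assumes P: "subgroup P S" and l: "l \<in> F P P"
    and n: "l [^]\<^bsub>Aut_group F P\<^esub> n = \<one>\<^bsub>Aut_group F P\<^esub>" "coprime n p"
  shows "l \<in> O_upper p (Aut_group F P)"
proof -
  interpret A: group "Aut_group F P" using P by (rule group_Aut_group)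
  have fin: "finite (carrier (Aut_group F P))" using finite_Aut by simp
  note O = A.O_upper_least[OF prime fin]
  obtain k where k: "card (rcosets\<^bsub>Aut_group F P\<^esub> O_upper p (Aut_group F P)) = p ^ k"
    using O(2) by blast
  have sub: "subgroup (O_upper p (Aut_group F P)) (Aut_group F P)"
    using A.normal_invE(1)[OF O(1)] .
  show ?thesis
  proof (rule A.coprime_powers_mem[OF sub])
    show "l \<in> carrier (Aut_group F P)" using l by simp
    then show "l [^]\<^bsub>Aut_group F P\<^esub> (p ^ k) \<in> O_upper p (Aut_group F P)"
      using A.index_power_mem[OF O(1)] k by metis
    show "l [^]\<^bsub>Aut_group F P\<^esub> n \<in> O_upper p (Aut_group F P)"
      unfolding n(1) by (rule subgroup.one_closed[OF sub])
    show "coprime (p ^ k) n" using n(2) by (simp add: coprime_commute)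
  qed
qed

text \<open>
  The commutator group \<open>[P, L]\<close>.
\<close>

definition displacement :: "'a set \<Rightarrow> ('a \<Rightarrow> 'a) set \<Rightarrow> 'a set" where
  "displacement P L = generate S {inv x \<otimes> l x | x l. x \<in> P \<and> l \<in> L}"

lemma displacement_le_hyperfocal:
  assumes P: "subgroup P S" and L: "coprime_family P L"
  shows "displacement P L \<subseteq> hyperfocal p S F"
  unfolding displacement_def hyperfocal_def
proof (rule mono_generate, safe)
  fix x l assume x: "x \<in> P" and l: "l \<in> L"
  have "l \<in> O_upper p (Aut_group F P)"
    using coprime_order_in_O_upper[OF P] L l unfolding coprime_family_def by blast
  then show "\<exists>y \<phi> Q. inv x \<otimes> l x = inv y \<otimes> \<phi> y \<and>
      subgroup Q S \<and> y \<in> Q \<and> \<phi> \<in> O_upper p (Aut_group F Q)"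
    using P x by blast
qed

lemma invariant_displacement:
  assumes P: "subgroup P S" and L: "coprime_family P L"
  shows "invariant_subgroup P (displacement P L)"
proof -
  let ?D = "{inv x \<otimes> l x | x l. x \<in> P \<and> l \<in> L}"
  have LF: "L \<subseteq> F P P" using L by (simp add: coprime_family_def)
  have DP: "?D \<subseteq> P"
    using LF hom_into subgroup.m_closed[OF P] subgroup.m_inv_closed[OF P] by blast
  then have DS: "?D \<subseteq> carrier S" using subgroup.subset[OF P] by blast
  have sub: "displacement P L \<subseteq> P"
    unfolding displacement_def using DP P by (rule generate_subgroup_incl)
  have grp: "subgroup (displacement P L) S"
    unfolding displacement_def using DS by (rule generate_is_subgroup)
  have "\<alpha> z \<in> displacement P L" if \<alpha>: "\<alpha> \<in> F P P" and z: "z \<in> displacement P L" for \<alpha> z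
  proof -
    have base: "\<alpha> d \<in> ?D" if "d \<in> ?D" for d
    proof -
      obtain x l where d: "d = inv x \<otimes> l x" "x \<in> P" "l \<in> L" using \<open>d \<in> ?D\<close> by blast
      have lF: "l \<in> F P P" using d LF by blast
      let ?\<gamma> = "inv\<^bsub>Aut_group F P\<^esub> \<alpha>"
      have \<gamma>: "?\<gamma> \<in> F P P" using Aut_group_inv(1)[OF \<alpha> d(2)] .
      obtain m where m: "m \<in> L" "\<forall>y\<in>P. l (?\<gamma> y) = ?\<gamma> (m y)"
        using L \<gamma> d(3) unfolding coprime_family_def by blast
      have ax: "\<alpha> x \<in> P" using hom_into[OF \<alpha> d(2)] .
      have "\<alpha> (l x) = \<alpha> (l (?\<gamma> (\<alpha> x)))" using Aut_group_inv(4)[OF \<alpha> d(2)] by simp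
      also have "\<dots> = m (\<alpha> x)"
        using m ax Aut_group_inv(3)[OF \<alpha>, of "m (\<alpha> x)"] LF hom_into[of m P P] by auto
      finally have "\<alpha> d = inv (\<alpha> x) \<otimes> m (\<alpha> x)"
        using d hom_into[OF lF d(2)] subgroup.m_inv_closed[OF P]
        by (simp add: hom_mult[OF \<alpha>] hom_inverse[OF \<alpha>])
      then show ?thesis using ax m(1) by blast
    qed
    have "z \<in> generate S ?D" using z by (simp add: displacement_def)
    then have "z \<in> P \<and> \<alpha> z \<in> generate S ?D"
    proof (induction rule: generate.induct)
      case one
      then show ?case using subgroup.one_closed[OF P] hom_unit[OF \<alpha>] generate.one by simp
    next
      case (incl h)
      then show ?case using base[OF incl] generate.incl[of "\<alpha> h" ?D S] DP by blast
    next
      case (inv h)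
      then have "h \<in> P" "\<alpha> h \<in> ?D" using base[OF inv] DP by blast+
      then show ?case
        using hom_inverse[OF \<alpha>] subgroup.m_inv_closed[OF P] generate.inv[of "\<alpha> h" ?D S] by simp
    next
      case (eng a b)
      then show ?case
        using hom_mult[OF \<alpha>] subgroup.m_closed[OF P] generate.eng[of "\<alpha> a" S ?D "\<alpha> b"] by simp
    qed
    then show ?thesis by (simp add: displacement_def)
  qed
  then show ?thesis using sub grp by (auto simp: invariant_subgroup_def)
qed

definition small_cyclic :: "'a set \<Rightarrow> bool" where
  "small_cyclic A \<longleftrightarrow> subgroup A S \<and> A \<subseteq> hyperfocal p S F \<and>
     cyclic_group (S\<lparr>carrier := A\<rparr>) \<and> (card A = p \<or> card A = 4)"

text \<open>
  For \<open>p = 2\<close> an element annihilated by \<open>4\<close> has order \<open>2 = p\<close> or \<open>4\<close>.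
\<close>

lemma cyclic_order_p_or_4:
  assumes x: "x \<in> carrier S" "x \<noteq> \<one>" and r: "x [^] (if p = 2 then 4 else p) = \<one>"
  shows "subgroup (generate S {x}) S" "cyclic_group (S\<lparr>carrier := generate S {x}\<rparr>)"
    "card (generate S {x}) = p \<or> card (generate S {x}) = 4"
proof -
  show "subgroup (generate S {x}) S" using x by (simp add: generate_is_subgroup)
  have "carrier S \<inter> {x} = {x}" using x by blast
  then show "cyclic_group (S\<lparr>carrier := generate S {x}\<rparr>)"
    using cyclic_group_generated[of x] by (simp add: subgroup_generated_def)
  have ord: "ord x dvd (if p = 2 then 4 else p)" using r pow_eq_id[OF x(1)] by blast
  have ne: "ord x \<noteq> 1" using ord_eq_1 x by blast
  have "ord x = p \<or> ord x = 4"
  proof (cases "p = 2")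
    case True
    have "ord x \<le> 4" "ord x \<noteq> 0" "ord x \<noteq> 3" using ord True by (auto dest: dvd_imp_le intro: ccontr)
    then show ?thesis using ne True by linarith
  next
    case False
    then show ?thesis using ord ne prime by (auto simp: prime_nat_iff)
  qed
  then show "card (generate S {x}) = p \<or> card (generate S {x}) = 4"
    using generate_pow_card[OF x(1)] by simp
qed

lemma restriction_to_cyclic:
  assumes \<alpha>: "\<alpha> \<in> F P P" and x: "x \<in> P"
  shows "restrict \<alpha> (generate S {x}) \<in> F (generate S {x}) (generate S {\<alpha> x})"
proof -
  have P: "subgroup P S" using objects \<alpha> by blast
  have xS: "x \<in> carrier S" "\<alpha> x \<in> carrier S" using hom_carrier[OF \<alpha> x] by auto
  have AP: "generate S {x} \<subseteq> P" using generate_subgroup_incl[OF _ P] x by blast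
  have gen: "generate S {y} = {y [^] k | k. k \<in> (UNIV :: nat set)}" if "y \<in> carrier S" for y
    using generate_pow_nat[OF that] ord_ge_1[OF finite_carrier that] by simp
  have "restrict \<alpha> (generate S {x}) \<in> F (generate S {x}) P"
    using restrict_hom[OF \<alpha> _ AP] generate_is_subgroup xS by simp
  moreover have "restrict \<alpha> (generate S {x}) ` generate S {x} \<subseteq> generate S {\<alpha> x}"
    using hom_power[OF \<alpha> x] xS by (auto simp: gen)
  ultimately show ?thesis using corestrict generate_is_subgroup xS by simp
qed

text \<open>
  \<open>[P, L]\<close> is invariant and contained in the hyperfocal subgroup, so the assumptions on small cyclic
  subgroups give the pointwise conditions under which \<open>L\<close> fixes \<open>[P, L]\<close>. Coprime action then makes \<open>L\<close>
  trivial on \<open>P\<close>.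
\<close>

lemma coprime_family_trivial:
  assumes P: "subgroup P S" and L: "coprime_family P L"
    and T: "T \<subseteq> F P P" "\<And>N. N \<lhd> Aut_group F P \<Longrightarrow> T \<subseteq> N \<Longrightarrow> L \<subseteq> N"
    and ext: "\<And>A B \<phi>. small_cyclic A \<Longrightarrow> small_cyclic B \<Longrightarrow> \<phi> \<in> F A B \<Longrightarrow>
      \<exists>\<beta> \<in> F (carrier S) (carrier S). restrict \<beta> A = \<phi>"
    and inner: "\<And>A B t. small_cyclic A \<Longrightarrow> small_cyclic B \<Longrightarrow> A \<subseteq> P \<Longrightarrow> t \<in> T \<Longrightarrow>
      restrict t A \<in> F A B \<Longrightarrow> \<exists>g \<in> carrier S. restrict t A = conj_map S A g"
    and l: "l \<in> L"
  shows "l = \<one>\<^bsub>Aut_group F P\<^esub>"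
proof -
  let ?W = "displacement P L" and ?r = "if p = 2 then 4 else p"
  have W: "invariant_subgroup P ?W" using invariant_displacement[OF P L] .
  have W': "subgroup ?W S" "?W \<subseteq> P" using W by (auto simp: invariant_subgroup_def)
  have hyp: "?W \<subseteq> hyperfocal p S F" using displacement_le_hyperfocal[OF P L] .
  have local_hom: "(\<exists>\<beta> \<in> F (carrier S) (carrier S). \<alpha> x = \<beta> x) \<and>
      (\<alpha> \<in> T \<longrightarrow> (\<exists>g \<in> carrier S. \<alpha> x = g \<otimes> x \<otimes> inv g))"
    if \<alpha>: "\<alpha> \<in> F P P" and x: "x \<in> ?W" and xr: "x [^] ?r = \<one>" for \<alpha> x
  proof (cases "x = \<one>")
    case True
    have "\<alpha> x = x" using hom_unit[OF \<alpha>] True by simp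
    moreover have "(\<lambda>x\<in>carrier S. x) \<in> F (carrier S) (carrier S)"
      using identity subgroup_self by blast
    moreover have "\<one> \<otimes> x \<otimes> inv \<one> = x" using True by simp
    ultimately show ?thesis using True by (metis one_closed restrict_apply')
  next
    case False
    have xP: "x \<in> P" using x W' by blast
    have xS: "x \<in> carrier S" "\<alpha> x \<in> carrier S" using hom_carrier[OF \<alpha> xP] by auto
    have ax: "\<alpha> x \<in> ?W" using W \<alpha> x by (auto simp: invariant_subgroup_def)
    have axr: "\<alpha> x [^] ?r = \<one>" using hom_power[OF \<alpha> xP, of ?r] hom_unit[OF \<alpha>] xr by simp
    have ax1: "\<alpha> x \<noteq> \<one>"
      using inj_onD[OF hom_inj[OF \<alpha>], of x \<one>] hom_unit[OF \<alpha>] False xP subgroup.one_closed[OF P]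
      by auto
    let ?A = "generate S {x}" and ?B = "generate S {\<alpha> x}"
    have AB: "?A \<subseteq> hyperfocal p S F" "?B \<subseteq> hyperfocal p S F"
      using generate_subgroup_incl[OF _ W'(1), of "{x}"] generate_subgroup_incl[OF _ W'(1), of "{\<alpha> x}"]
        x ax hyp by auto
    have A: "small_cyclic ?A" and B: "small_cyclic ?B"
      using cyclic_order_p_or_4[OF xS(1) False xr] cyclic_order_p_or_4[OF xS(2) ax1 axr] AB
      by (auto simp: small_cyclic_def)
    have \<phi>: "restrict \<alpha> ?A \<in> F ?A ?B" using restriction_to_cyclic[OF \<alpha> xP] .
    have xA: "x \<in> ?A" by (rule generate.incl) simp
    obtain \<beta> where \<beta>: "\<beta> \<in> F (carrier S) (carrier S)" "restrict \<beta> ?A = restrict \<alpha> ?A"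
      using ext[OF A B \<phi>] by blast
    have "\<alpha> x = \<beta> x" using fun_cong[OF \<beta>(2), of x] xA by simp
    then have "\<exists>\<beta> \<in> F (carrier S) (carrier S). \<alpha> x = \<beta> x" using \<beta>(1) by blast
    moreover have "\<exists>g \<in> carrier S. \<alpha> x = g \<otimes> x \<otimes> inv g" if t: "\<alpha> \<in> T"
    proof -
      obtain g where g: "g \<in> carrier S" "restrict \<alpha> ?A = conj_map S ?A g"
        using inner[OF A B _ t \<phi>] generate_subgroup_incl[OF _ P, of "{x}"] xP by blast
      have "\<alpha> x = g \<otimes> x \<otimes> inv g"
        using fun_cong[OF g(2), of x] xA by (simp add: conj_map_def)
      then show ?thesis using g(1) by blast
    qed
    ultimately show ?thesis by blast
  qed
  have fixW: "fixed_points L ?W = ?W"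
  proof (rule coprime_family_fixes_invariant[OF L P T _ _ W subset_refl])
    show "\<exists>\<beta> \<in> F (carrier S) (carrier S). \<alpha> x = \<beta> x"
      if "\<alpha> \<in> F P P" "x \<in> ?W" "x [^] ?r = \<one>" for \<alpha> x
      using local_hom[OF that] by blast
    show "\<exists>g \<in> carrier S. t x = g \<otimes> x \<otimes> inv g" if "t \<in> T" "x \<in> ?W" "x [^] ?r = \<one>" for t x
      using local_hom[OF subsetD[OF T(1) that(1)] that(2,3)] that(1) by blast
  qed
  have "invariant_subgroup P P" using P hom_into by (auto simp: invariant_subgroup_def)
  then have "fixed_points L P = P"
  proof (rule fixes_all_if_differences_fixed[OF _ L])
    fix x l assume "x \<in> P" "l \<in> L"
    then have "inv x \<otimes> l x \<in> ?W"
      unfolding displacement_def by (intro generate.incl) blast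
    then show "inv x \<otimes> l x \<in> fixed_points L P"
      using fixW W'(2) unfolding fixed_points_def by blast
  qed
  then have "\<forall>x\<in>P. l x = x" using l unfolding fixed_points_def by blast
  moreover have "l \<in> extensional P" using l L hom_ext unfolding coprime_family_def by blast
  ultimately have "l = (\<lambda>x\<in>P. x)" by (auto simp: fun_eq_iff extensional_def)
  then show ?thesis by simp
qed

text \<open>
  The elements of order prime to \<open>p\<close> in the normal closure form a conjugation-invariant family, to
  which the preceding lemma applies with every normal subgroup containing \<open>T\<close> containing the family.
  So only the unit has order prime to \<open>p\<close>.
\<close>

lemma normal_closure_p_group:
  assumes P: "subgroup P S" and T: "T \<subseteq> F P P"
    and ext: "\<And>A B \<phi>. small_cyclic A \<Longrightarrow> small_cyclic B \<Longrightarrow> \<phi> \<in> F A B \<Longrightarrow>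
      \<exists>\<beta> \<in> F (carrier S) (carrier S). restrict \<beta> A = \<phi>"
    and inner: "\<And>A B t. small_cyclic A \<Longrightarrow> small_cyclic B \<Longrightarrow> A \<subseteq> P \<Longrightarrow> t \<in> T \<Longrightarrow>
      restrict t A \<in> F A B \<Longrightarrow> \<exists>g \<in> carrier S. restrict t A = conj_map S A g"
  shows "\<exists>k. card (normal_closure (Aut_group F P) T) = p ^ k"
proof -
  let ?A = "Aut_group F P"
  interpret A: group ?A using P by (rule group_Aut_group)
  let ?B = "normal_closure ?A T"
  have TA: "T \<subseteq> carrier ?A" using T by simp
  note B = A.normal_closure[OF TA]
  have sB: "subgroup ?B ?A" using A.normal_invE(1)[OF B(1)] .
  have finB: "finite ?B" using subgroup.subset[OF sB] finite_Aut finite_subset by fastforce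
  let ?L = "{l \<in> ?B. \<exists>n. coprime n p \<and> l [^]\<^bsub>?A\<^esub> n = \<one>\<^bsub>?A\<^esub>}"
  have L: "coprime_family P ?L" by (rule coprime_family_of_normal[OF P B(1)])
  have trivial: "l = \<one>\<^bsub>?A\<^esub>" if l: "l \<in> ?L" for l
  proof (rule coprime_family_trivial[OF P L T _ _ _ l])
    show "?L \<subseteq> N" if "N \<lhd> ?A" "T \<subseteq> N" for N using B(3)[OF that] by blast
  qed (use ext inner in blast)+
  interpret B: group "?A\<lparr>carrier := ?B\<rparr>" using sB by (rule subgroup.subgroup_is_group[OF _ A.is_group])
  have "\<exists>k. order (?A\<lparr>carrier := ?B\<rparr>) = p ^ k"
  proof (rule B.prime_power_order_if_no_coprime_order[OF prime])
    show "finite (carrier (?A\<lparr>carrier := ?B\<rparr>))" using finB by simp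
    fix x and n :: nat
    assume x: "x \<in> carrier (?A\<lparr>carrier := ?B\<rparr>)" "coprime n p"
      "x [^]\<^bsub>?A\<lparr>carrier := ?B\<rparr>\<^esub> n = \<one>\<^bsub>?A\<lparr>carrier := ?B\<rparr>\<^esub>"
    then have "x [^]\<^bsub>?A\<^esub> n = \<one>\<^bsub>?A\<^esub>" by (simp add: A.nat_pow_consistent[symmetric])
    then have "x \<in> ?L" using x by auto
    then show "x = \<one>\<^bsub>?A\<lparr>carrier := ?B\<rparr>\<^esub>" using trivial by simp
  qed
  then show ?thesis by (simp add: order_def)
qed

text \<open>
  A \<open>p\<close>-subgroup that contains a Sylow subgroup is equal to it.
\<close>

lemma sylow_normal_if_closure_p_group:
  assumes P: "subgroup P S" and T: "sylow_subgroup p (Aut_group F P) T"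
    and B: "card (normal_closure (Aut_group F P) T) = p ^ k"
  shows "T \<lhd> Aut_group F P"
proof -
  let ?A = "Aut_group F P"
  interpret A: group ?A using P by (rule group_Aut_group)
  let ?B = "normal_closure ?A T"
  have sT: "subgroup T ?A" and cT: "card T = p ^ multiplicity p (order ?A)"
    using T by (auto simp: sylow_subgroup_def)
  note C = A.normal_closure[OF subgroup.subset[OF sT]]
  have sB: "subgroup ?B ?A" using A.normal_invE(1)[OF C(1)] .
  have finA: "finite (carrier ?A)" using finite_Aut by simp
  then have finB: "finite ?B" using subgroup.subset[OF sB] finite_subset by blast
  have "p ^ k dvd order ?A" using A.lagrange[OF sB] B by (metis dvd_triv_right)
  moreover have "order ?A \<noteq> 0" using finA A.order_gt_0_iff_finite by simp
  ultimately have "k \<le> multiplicity p (order ?A)"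
    using prime not_prime_unit by (intro multiplicity_geI) auto
  then have "card ?B \<le> card T" unfolding B cT using prime_ge_1_nat[OF prime] by (intro power_increasing)
  then have "T = ?B" using card_seteq[OF finB C(2)] by simp
  then show ?thesis using C(1) by simp
qed

section \<open>Extension of morphisms to S\<close>

lemma normalizes_imp_in_normalizer:
  assumes Q: "subgroup Q S" and g: "g \<in> carrier S" "\<And>x. x \<in> Q \<Longrightarrow> g \<otimes> x \<otimes> inv g \<in> Q"
  shows "g \<in> normalizer S Q" "conj_map S Q g \<in> F Q Q"
proof -
  have "conj_map S Q g ` Q \<subseteq> Q" using g(2) by (auto simp: conj_map_def)
  then show c: "conj_map S Q g \<in> F Q Q"
    using inner_fusionI[OF Q Q g(1)] inner_le by blast
  then have "conj_map S Q g \<in> Bij Q" using endo_Bij by blast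
  then have "conj_map S Q g ` Q = Q" by (simp add: Bij_def bij_betw_def)
  moreover have "g <# Q #> inv g = conj_map S Q g ` Q"
    by (auto simp: l_coset_def r_coset_def conj_map_def)
  ultimately show "g \<in> normalizer S Q"
    using g(1) subgroup.subset[OF Q] by (simp add: normalizer_def stabilizer_def)
qed

text \<open>
  Transport along \<open>\<phi>\<close> of the conjugation by \<open>g\<close> is an element of \<open>Aut\<^sub>F(P)\<close> of \<open>p\<close>-power order, and a
  normal Sylow subgroup contains all of these. So every \<open>g\<close> that normalizes \<open>Q\<close> belongs to \<open>N\<^sub>\<phi>\<close>.
\<close>

lemma N_map_contains:
  assumes \<phi>: "\<phi> \<in> isos F Q P" and T: "inner_fusion S P P \<lhd> Aut_group F P"
    and syl: "sylow_subgroup p (Aut_group F P) (inner_fusion S P P)"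
    and g: "g \<in> carrier S" "\<And>x. x \<in> Q \<Longrightarrow> g \<otimes> x \<otimes> inv g \<in> Q"
  shows "g \<in> N_map S Q P \<phi>"
proof -
  have F: "\<phi> \<in> F Q P" and bij: "bij_betw \<phi> Q P" using \<phi> iso_bij by (auto simp: isos_def)
  have Q: "subgroup Q S" and P: "subgroup P S" using objects[OF F] by auto
  note memQ = subgroup.mem_carrier[OF Q]
  let ?A = "Aut_group F P" and ?T = "inner_fusion S P P"
  interpret A: group ?A using P by (rule group_Aut_group)
  have finA: "finite (carrier ?A)" using finite_Aut by simp
  let ?c = "conj_map S Q g" and ?\<psi> = "\<lambda>x\<in>P. inv_into Q \<phi> x"
  let ?b = "compose P (compose Q \<phi> ?c) (inv_into Q \<phi>)"
  have c: "?c \<in> F Q Q" and norm: "g \<in> normalizer S Q" using normalizes_imp_in_normalizer[OF Q g] by auto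
  have \<psi>: "?\<psi> \<in> F P Q" using iso_inverse[OF F] bij by (simp add: bij_betw_def)
  have "compose P (compose Q \<phi> ?c) ?\<psi> \<in> F P P" by (rule composition[OF \<psi> composition[OF c F]])
  moreover have "compose P (compose Q \<phi> ?c) ?\<psi> = ?b" by (auto simp: compose_def)
  ultimately have b: "?b \<in> F P P" by simp
  have conj: "g [^] k \<otimes> y \<otimes> inv (g [^] k) \<in> Q" if "y \<in> Q" for y and k :: nat
    using that
  proof (induction k arbitrary: y)
    case (Suc k)
    have "g [^] k \<otimes> (g \<otimes> y \<otimes> inv g) \<otimes> inv (g [^] k) \<in> Q" using Suc g by blast
    moreover have "g [^] k \<otimes> (g \<otimes> y \<otimes> inv g) \<otimes> inv (g [^] k) = g [^] Suc k \<otimes> y \<otimes> inv (g [^] Suc k)"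
      using g(1) memQ[OF Suc.prems] by (simp add: m_assoc inv_mult_group)
    ultimately show ?case by simp
  qed (use memQ in simp)
  have inv\<phi>: "inv_into Q \<phi> (\<phi> y) = y" "\<phi> y \<in> P" if "y \<in> Q" for y
    using that bij hom_into[OF F] by (auto simp: bij_betw_def)
  have b\<phi>: "?b (\<phi> y) = \<phi> (g \<otimes> y \<otimes> inv g)" if "y \<in> Q" for y
    using inv\<phi>[OF that] that by (simp add: compose_eq conj_map_def)
  have iter: "(?b [^]\<^bsub>?A\<^esub> k) (\<phi> y) = \<phi> (g [^] k \<otimes> y \<otimes> inv (g [^] k))" if "y \<in> Q" for y and k :: nat
    using that
  proof (induction k arbitrary: y)
    case 0
    then show ?case using inv\<phi>(2) memQ by simp
  next
    case (Suc k)
    have bk: "?b [^]\<^bsub>?A\<^esub> k \<in> F P P" using A.nat_pow_closed[of ?b k] b by simp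
    have y': "g \<otimes> y \<otimes> inv g \<in> Q" using g(2) Suc.prems .
    have "(?b [^]\<^bsub>?A\<^esub> Suc k) (\<phi> y) = (?b [^]\<^bsub>?A\<^esub> k) (?b (\<phi> y))"
      using inv\<phi>(2)[OF Suc.prems] by (simp only: A.nat_pow_Suc Aut_group_mult[OF bk b] compose_eq)
    also have "\<dots> = \<phi> (g [^] k \<otimes> (g \<otimes> y \<otimes> inv g) \<otimes> inv (g [^] k))"
      unfolding b\<phi>[OF Suc.prems] by (rule Suc.IH[OF y'])
    also have "g [^] k \<otimes> (g \<otimes> y \<otimes> inv g) \<otimes> inv (g [^] k) = g [^] Suc k \<otimes> y \<otimes> inv (g [^] Suc k)"
      using g(1) memQ[OF Suc.prems] by (simp add: m_assoc inv_mult_group)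
    finally show ?case .
  qed
  have bN: "?b [^]\<^bsub>?A\<^esub> order S = \<one>\<^bsub>?A\<^esub>"
  proof -
    let ?e = "?b [^]\<^bsub>?A\<^esub> order S"
    have e: "?e \<in> F P P" using A.nat_pow_closed[of ?b "order S"] b by simp
    have "?e x = x" if x: "x \<in> P" for x
    proof -
      obtain y where y: "y \<in> Q" "x = \<phi> y" using x bij_betw_imp_surj_on[OF bij] by blast
      then show ?thesis using iter[OF y(1), of "order S"] pow_order_eq_1[OF g(1)] memQ by simp
    qed
    then show ?thesis using hom_ext[OF e] by (auto simp: fun_eq_iff extensional_def)
  qed
  have sT: "subgroup ?T ?A" using A.normal_invE(1)[OF T] .
  have "?b \<in> ?T"
  proof (rule A.coprime_powers_mem[OF sT])
    show bA: "?b \<in> carrier ?A" using b by simp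
    show "?b [^]\<^bsub>?A\<^esub> order S \<in> ?T" unfolding bN by (rule subgroup.one_closed[OF sT])
    show "?b [^]\<^bsub>?A\<^esub> card (rcosets\<^bsub>?A\<^esub> ?T) \<in> ?T" by (rule A.index_power_mem[OF T bA])
    have "\<not> p dvd card (rcosets\<^bsub>?A\<^esub> ?T)"
    proof
      assume "p dvd card (rcosets\<^bsub>?A\<^esub> ?T)"
      then have "p * card ?T dvd order ?A"
        using A.lagrange[OF sT] by (metis dvd_refl mult_dvd_mono)
      then have "p ^ Suc (multiplicity p (order ?A)) dvd order ?A"
        using syl by (simp add: sylow_subgroup_def)
      moreover have "order ?A \<noteq> 0" using finA A.order_gt_0_iff_finite by simp
      ultimately have "Suc (multiplicity p (order ?A)) \<le> multiplicity p (order ?A)"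
        using prime not_prime_unit by (intro multiplicity_geI) auto
      then show False by simp
    qed
    then show "coprime (order S) (card (rcosets\<^bsub>?A\<^esub> ?T))"
      using p_power_order prime prime_imp_coprime by (metis coprime_power_left_iff)
  qed
  then show ?thesis using norm by (simp add: N_map_def)
qed

end

text \<open>
  By downward induction on the order of \<open>Q\<close>. For \<open>Q \<noteq> S\<close> let \<open>P\<close> be the representative of \<open>Q\<close> provided by
  saturation. An isomorphism onto \<open>P\<close> extends to the normalizer of its domain, which is strictly
  larger, and then by induction to \<open>S\<close>. An arbitrary \<open>\<phi>\<close> with domain \<open>Q\<close> is a quotient of two such
  isomorphisms, from \<open>Q\<close> and from its image.
\<close>

lemma (in saturated_fusion_system) extends_if_sylow_normal:
  assumes normal: "\<And>P. subgroup P S \<Longrightarrow> sylow_subgroup p (Aut_group F P) (inner_fusion S P P) \<Longrightarrow>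
    inner_fusion S P P \<lhd> Aut_group F P"
    and \<phi>: "\<phi> \<in> F Q R"
  shows "\<exists>\<beta> \<in> F (carrier S) (carrier S). restrict \<beta> Q = \<phi>"
  using \<phi>
proof (induction "order S - card Q" arbitrary: Q R \<phi> rule: less_induct)
  case less
  let ?C = "carrier S"
  have Q: "subgroup Q S" and R: "subgroup R S" using objects[OF less.prems] by auto
  have QC: "Q \<subseteq> ?C" using subgroup.subset[OF Q] .
  show ?case
  proof (cases "Q = ?C")
    case True
    have "\<phi> \<in> F ?C ?C"
      using corestrict[OF less.prems subgroup_self] hom_carrier[OF less.prems] True by auto
    moreover have "restrict \<phi> Q = \<phi>" using hom_ext[OF less.prems] by (rule extensional_restrict)
    ultimately show ?thesis by blast
  next
    case False
    then have cQ: "card Q < order S"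
      using psubset_card_mono[OF finite_carrier, of Q] QC by (auto simp: order_def)
    obtain P where P: "subgroup P S" "isos F Q P \<noteq> {}"
      "sylow_subgroup p (Aut_group F P) (inner_fusion S P P)"
      and receptive: "\<And>Q' \<theta>. \<theta> \<in> isos F Q' P \<Longrightarrow>
        \<exists>\<psi> \<in> F (N_map S Q' P \<theta>) ?C. restrict \<psi> Q' = \<theta>"
      using saturated[OF Q] by blast
    have step: "\<exists>\<beta> \<in> F ?C ?C. restrict \<beta> Q' = \<theta>" if \<theta>: "\<theta> \<in> isos F Q' P" and card: "card Q' = card Q" for Q' \<theta>
    proof -
      have Q': "subgroup Q' S" using objects \<theta> by (auto simp: isos_def)
      have Q'C: "Q' \<noteq> ?C" using cQ card by (auto simp: order_def)
      note contains = N_map_contains[OF \<theta> normal[OF P(1,3)] P(3)]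
      obtain x where x: "x \<in> ?C" "x \<notin> Q'" "\<forall>k\<in>Q'. x \<otimes> k \<otimes> inv x \<in> Q'"
        using normalizer_grows[OF Q' Q'C] by blast
      let ?N = "N_map S Q' P \<theta>"
      have "x \<in> ?N" using contains[OF x(1)] x(3) by blast
      moreover have Q'N: "Q' \<subseteq> ?N"
      proof
        fix g assume g: "g \<in> Q'"
        show "g \<in> ?N"
          using contains[OF subgroup.mem_carrier[OF Q' g]] g
            subgroup.m_closed[OF Q'] subgroup.m_inv_closed[OF Q'] by blast
      qed
      ultimately have "Q' \<subset> ?N" using x(2) by blast
      obtain \<psi> where \<psi>: "\<psi> \<in> F ?N ?C" "restrict \<psi> Q' = \<theta>" using receptive[OF \<theta>] by blast
      have N: "subgroup ?N S" using objects[OF \<psi>(1)] by blast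
      have "card Q < card ?N"
        using psubset_card_mono[OF subgroup_finite[OF N] \<open>Q' \<subset> ?N\<close>] card by simp
      then have "order S - card ?N < order S - card Q" using cQ by simp
      then obtain \<beta> where \<beta>: "\<beta> \<in> F ?C ?C" "restrict \<beta> ?N = \<psi>" using less.hyps \<psi>(1) by blast
      have "restrict \<beta> Q' = restrict (restrict \<beta> ?N) Q'"
        by (simp only: restrict_restrict Int_absorb1[OF Q'N])
      also have "\<dots> = \<theta>" unfolding \<beta>(2) by (rule \<psi>(2))
      finally show ?thesis using \<beta>(1) by blast
    qed
    obtain \<theta> where \<theta>: "\<theta> \<in> isos F Q P" using P(2) by blast
    then have \<theta>F: "\<theta> \<in> F Q P" and \<theta>b: "bij_betw \<theta> Q P" using iso_bij by (auto simp: isos_def)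
    let ?R = "\<phi> ` Q"
    interpret h: group_hom "S\<lparr>carrier := Q\<rparr>" S \<phi> using hom_group_hom[OF less.prems] .
    have R': "subgroup ?R S" using h.img_is_subgroup by simp
    have \<phi>R: "\<phi> \<in> F Q ?R" using corestrict[OF less.prems R'] by blast
    let ?\<chi> = "\<lambda>x\<in>?R. inv_into Q \<phi> x"
    have \<chi>: "?\<chi> \<in> F ?R Q" using iso_inverse[OF \<phi>R] by simp
    \<comment> \<open>\<open>\<tau> = \<theta> \<phi>\<inverse>\<close> maps the image of \<open>\<phi>\<close> onto \<open>P\<close>; if \<open>\<beta>\<close> extends \<open>\<tau>\<close> and \<open>\<gamma>\<close> extends \<open>\<theta>\<close>, then \<open>\<beta>\<inverse> \<gamma>\<close> extends \<open>\<phi>\<close>\<close>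
    let ?\<tau> = "compose ?R \<theta> ?\<chi>"
    have \<chi>\<phi>: "?\<chi> (\<phi> y) = y" if "y \<in> Q" for y using that hom_inj[OF less.prems] by simp
    have \<tau>\<phi>: "?\<tau> (\<phi> y) = \<theta> y" if "y \<in> Q" for y using that \<chi>\<phi>[OF that] by (simp only: compose_eq imageI)
    have "?\<tau> ` ?R = P" using \<tau>\<phi> \<theta>b by (auto simp: bij_betw_def image_image)
    then have \<tau>: "?\<tau> \<in> isos F ?R P" using isosI[OF composition[OF \<chi> \<theta>F]] by blast
    have "card ?R = card Q" using card_image hom_inj[OF less.prems] by blast
    then obtain \<beta> where \<beta>: "\<beta> \<in> F ?C ?C" "restrict \<beta> ?R = ?\<tau>" using step[OF \<tau>] by blast
    obtain \<gamma> where \<gamma>: "\<gamma> \<in> F ?C ?C" "restrict \<gamma> Q = \<theta>" using step[OF \<theta> refl] by blast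
    let ?\<beta>' = "inv\<^bsub>Aut_group F ?C\<^esub> \<beta>"
    have \<beta>': "?\<beta>' \<in> F ?C ?C" using Aut_group_inv(1)[OF \<beta>(1) one_closed] .
    have "restrict (compose ?C ?\<beta>' \<gamma>) Q = \<phi>"
    proof (rule extensionalityI)
      show "\<phi> \<in> extensional Q" using hom_ext[OF less.prems] .
      fix y assume y: "y \<in> Q"
      have "\<gamma> y = \<theta> y" using fun_cong[OF \<gamma>(2), of y] y by simp
      also have "\<dots> = ?\<tau> (\<phi> y)" using \<tau>\<phi>[OF y] by (rule sym)
      also have "\<dots> = \<beta> (\<phi> y)" unfolding \<beta>(2)[symmetric] using y by simp
      finally have "\<gamma> y = \<beta> (\<phi> y)" .
      moreover have "\<phi> y \<in> ?C" using hom_carrier[OF less.prems y] by blast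
      ultimately have "?\<beta>' (\<gamma> y) = \<phi> y" using Aut_group_inv(4)[OF \<beta>(1)] by simp
      then show "restrict (compose ?C ?\<beta>' \<gamma>) Q y = \<phi> y" using y QC by (auto simp: compose_eq)
    qed simp
    then show ?thesis using composition[OF \<gamma>(1) \<beta>'] by blast
  qed
qed

theorem theorem2:
  fixes S :: "('a, 'b) monoid_scheme" and p :: nat
    and F G :: "'a set \<Rightarrow> 'a set \<Rightarrow> ('a \<Rightarrow> 'a) set"
  assumes "prime p"
    and "finite_p_group S p"
    and "saturated_fusion_system S p F"
    and "G = normalizer_fusion S F \<or> G = inner_fusion S"
    and "\<And>A B. subgroup A S \<Longrightarrow> A \<subseteq> hyperfocal p S F \<Longrightarrow>
           subgroup B S \<Longrightarrow> B \<subseteq> hyperfocal p S F \<Longrightarrow>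
           cyclic_group (S\<lparr>carrier := A\<rparr>) \<Longrightarrow> card A = p \<or> card A = 4 \<Longrightarrow>
           cyclic_group (S\<lparr>carrier := B\<rparr>) \<Longrightarrow> card B = p \<or> card B = 4 \<Longrightarrow>
           G A B = F A B"
  shows "G = F"
proof -
  interpret saturated_fusion_system S p F by (rule assms(3))
  let ?C = "carrier S"
  have control: "G A B = F A B" if "small_cyclic A" "small_cyclic B" for A B
    using assms(5) that unfolding small_cyclic_def by blast
  interpret N: fusion_system S p "normalizer_fusion S F" by (rule fusion_system_normalizer_fusion)
  \<comment> \<open>conjugations by elements of \<open>S\<close> extend to \<open>S\<close>, so both cases control fusion in the normalizer\<close>
  have "G A B \<subseteq> normalizer_fusion S F A B" for A B
    using assms(4) N.inner_le by blast
  then have extS: "\<exists>\<beta> \<in> F ?C ?C. restrict \<beta> A = \<phi>" if "small_cyclic A" "small_cyclic B" "\<phi> \<in> F A B" for A B \<phi>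
    using control[OF that(1,2)] that(3) unfolding normalizer_fusion_def by blast
  have normal: "inner_fusion S P P \<lhd> Aut_group F P"
    if P: "subgroup P S" and syl: "sylow_subgroup p (Aut_group F P) (inner_fusion S P P)" for P
  proof -
    have inner: "\<exists>g \<in> ?C. restrict t A = conj_map S A g"
      if t: "t \<in> inner_fusion S P P" and A: "A \<subseteq> P" for A t
    proof -
      obtain g where g: "g \<in> ?C" "t = conj_map S P g" using t by (auto simp: inner_fusion_def)
      have "restrict t A = conj_map S A g"
        unfolding g(2) conj_map_def restrict_restrict Int_absorb1[OF A] by (rule refl)
      then show ?thesis using g(1) by blast
    qed
    have "\<exists>k. card (normal_closure (Aut_group F P) (inner_fusion S P P)) = p ^ k"
      by (rule normal_closure_p_group[OF P inner_le]) (rule extS inner; assumption)+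
    then show ?thesis using sylow_normal_if_closure_p_group[OF P syl] by blast
  qed
  have extends: "\<exists>\<beta> \<in> F ?C ?C. restrict \<beta> Q = \<phi>" if "\<phi> \<in> F Q R" for Q R \<phi>
    by (rule extends_if_sylow_normal[OF normal that])
  from assms(4) show ?thesis
  proof
    assume "G = normalizer_fusion S F"
    moreover have "normalizer_fusion S F Q R = F Q R" for Q R
      using extends unfolding normalizer_fusion_def by blast
    ultimately show ?thesis by (simp add: fun_eq_iff)
  next
    assume G: "G = inner_fusion S"
    have inner: "\<exists>g \<in> ?C. restrict t A = conj_map S A g"
      if "small_cyclic A" "small_cyclic B" "restrict t A \<in> F A B" for A B t
      using control[OF that(1,2)] that(3) unfolding G inner_fusion_def by blast
    have "\<exists>k. card (normal_closure (Aut_group F ?C) (F ?C ?C)) = p ^ k"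
      by (rule normal_closure_p_group[OF subgroup_self subset_refl]) (rule extS inner; assumption)+
    then obtain k where k: "card (normal_closure (Aut_group F ?C) (F ?C ?C)) = p ^ k" by blast
    interpret A: group "Aut_group F ?C" using subgroup_self by (rule group_Aut_group)
    have "normal_closure (Aut_group F ?C) (F ?C ?C) = F ?C ?C"
      using A.normal_closure(2)[of "F ?C ?C"] A.normal_closure(3)[OF _ A.normal_self] by force
    then have card_F: "card (F ?C ?C) = p ^ k" using k by simp
    obtain P where P: "isos F ?C P \<noteq> {}" "subgroup P S"
      "sylow_subgroup p (Aut_group F P) (inner_fusion S P P)"
      using saturated[OF subgroup_self] by blast
    obtain \<theta> where "bij_betw \<theta> ?C P" using P(1) iso_bij by blast
    then have "card P = card ?C" using bij_betw_same_card by fastforce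
    then have "P = ?C" using card_subset_eq[OF finite_carrier subgroup.subset[OF P(2)]] by blast
    then have "card (inner_fusion S ?C ?C) = p ^ multiplicity p (p ^ k)"
      using P(3) card_F by (simp add: sylow_subgroup_def order_def)
    also have "multiplicity p (p ^ k) = k"
      using prime not_prime_unit by (intro multiplicity_same_power) auto
    finally have eq: "inner_fusion S ?C ?C = F ?C ?C"
      using card_F card_subset_eq[OF finite_Aut inner_le] by simp
    have "F Q R \<subseteq> inner_fusion S Q R" for Q R
    proof
      fix \<phi> assume \<phi>: "\<phi> \<in> F Q R"
      have Q: "subgroup Q S" and R: "subgroup R S" using objects[OF \<phi>] by auto
      obtain \<beta> where \<beta>: "\<beta> \<in> inner_fusion S ?C ?C" "restrict \<beta> Q = \<phi>"
        using extends[OF \<phi>] eq by blast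
      then obtain g where g: "g \<in> ?C" "\<beta> = conj_map S ?C g" by (auto simp: inner_fusion_def)
      have "\<phi> = conj_map S Q g"
        unfolding \<beta>(2)[symmetric] g(2) conj_map_def restrict_restrict
          Int_absorb1[OF subgroup.subset[OF Q]] by (rule refl)
      then show "\<phi> \<in> inner_fusion S Q R"
        using inner_fusionI[OF Q R g(1)] hom_into[OF \<phi>] by blast
    qed
    then show ?thesis unfolding G by (intro ext equalityI inner_le)
  qed
qed

end
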